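(* The poset $\mathfrak P_{\mathrm{Malt}}$ is isomorphic to the poset $\mathfrak P_{\mathrm{UC}}$ with a single element $[\mathbb P_1]$ inserted as unique lower cover of $[\mathbb C_1]$. The covering relation of $\mathfrak P_{\mathrm{Malt}}$ is the covering relation of $\mathfrak P_{\mathrm{Digraphs}}$ restricted to $\mathfrak P_{\mathrm{Malt}}$.
   Context: Structures have nonempty domains; a digraph is a structure with one binary relation. A primitive positive (pp) formula is a first-order formula built from atomic formulas $R(x_1,\dots,x_n)$, $x\approx y$, and the always-false formula $\bot$ using only conjunction and existential quantification. A structure is a pp-power of $\mathbb A$ if it is isomorphic to a structure with domain $A^n$ for some $n\geq 1$ whose relations are pp-definable in $\mathbb A$ (a $k$-ary relation on $A^n$ being regarded as a $kn$-ary relation on $A$). $\mathbb A\leq\mathbb B$ means that $\mathbb B$ is homomorphically equivalent to a pp-power of $\mathbb A$; this is a quasi-order, and $[\mathbb A]$ denotes the class of $\mathbb A$ under the induced equivalence. All the posets below are ordered by $[\mathbb A]\leq[\mathbb B]$ iff $\mathbb A\leq\mathbb B$. $\mathfrak P_{\mathrm{Digraphs}}$ consists of all $[\mathbb G]$ with $\mathbb G$ a finite digraph. $\mathfrak P_{\mathrm{Malt}}$ consists of all $[\mathbb G]$ with $\mathbb G$ a finite digraph that has a quasi Maltsev polymorphism, i.e. a homomorphism $f\colon\mathbb G^3\to\mathbb G$ with $f(y,y,x)=f(x,x,x)=f(x,y,y)$ for all $x,y$. $\mathfrak P_{\mathrm{UC}}$ consists of all $[\mathbb C]$ with $\mathbb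 C$ a finite disjoint union of directed cycles (a finite digraph in which every vertex has exactly one incoming and exactly one outgoing edge). $\mathbb P_1=(\{0,1\},\{(0,1)\})$ is a single directed edge and $\mathbb C_1$ is a single loop; $[\mathbb C_1]$ is the top element. *)

theory Defs
  imports Main
begin

section \<open>Relational structures\<close>

text \<open>
  The symbols of the signature are all the elements of the type \<open>'s\<close>; relations are sets of
  lists, where a list of length \<open>k\<close> is a \<open>k\<close>-tuple.
\<close>

record ('s, 'a) struc =
  universe :: "'a set"
  arity :: "'s \<Rightarrow> nat"
  interp :: "'s \<Rightarrow> 'a list set"

definition tuples :: "'a set \<Rightarrow> nat \<Rightarrow> 'a list set" where
  "tuples A n = {xs. length xs = n \<and> set xs \<subseteq> A}"

definition is_struc :: "('s, 'a) struc \<Rightarrow> bool" where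
  "is_struc A \<longleftrightarrow> universe A \<noteq> {} \<and> (\<forall>s. interp A s \<subseteq> tuples (universe A) (arity A s))"

definition is_hom :: "('a \<Rightarrow> 'b) \<Rightarrow> ('s, 'a) struc \<Rightarrow> ('s, 'b) struc \<Rightarrow> bool" where
  "is_hom f A B \<longleftrightarrow>
     arity A = arity B \<and>
     f ` universe A \<subseteq> universe B \<and>
     (\<forall>s. \<forall>t \<in> interp A s. map f t \<in> interp B s)"

definition hom_equivalent :: "('s, 'a) struc \<Rightarrow> ('s, 'b) struc \<Rightarrow> bool" where
  "hom_equivalent A B \<longleftrightarrow> (\<exists>f. is_hom f A B) \<and> (\<exists>g. is_hom g B A)"

definition isomorphic :: "('s, 'a) struc \<Rightarrow> ('s, 'b) struc \<Rightarrow> bool" where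
  "isomorphic A B \<longleftrightarrow>
     arity A = arity B \<and>
     (\<exists>f. bij_betw f (universe A) (universe B) \<and>
          (\<forall>s. \<forall>t \<in> tuples (universe A) (arity A s). t \<in> interp A s \<longleftrightarrow> map f t \<in> interp B s))"


section \<open>Primitive positive formulas and pp-constructability\<close>

text \<open>Variables are natural numbers.\<close>

datatype 's pp =
    Bot
  | Eq nat nat
  | Rel 's "nat list"
  | And "'s pp" "'s pp"
  | Ex nat "'s pp"

primrec pp_wf :: "('s \<Rightarrow> nat) \<Rightarrow> 's pp \<Rightarrow> bool" where
  "pp_wf ar Bot \<longleftrightarrow> True"
| "pp_wf ar (Eq x y) \<longleftrightarrow> True"
| "pp_wf ar (Rel s xs) \<longleftrightarrow> length xs = ar s"
| "pp_wf ar (And \<phi> \<psi>) \<longleftrightarrow> pp_wf ar \<phi> \<and> pp_wf ar \<psi>"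
| "pp_wf ar (Ex x \<phi>) \<longleftrightarrow> pp_wf ar \<phi>"

primrec pp_fv :: "'s pp \<Rightarrow> nat set" where
  "pp_fv Bot = {}"
| "pp_fv (Eq x y) = {x, y}"
| "pp_fv (Rel s xs) = set xs"
| "pp_fv (And \<phi> \<psi>) = pp_fv \<phi> \<union> pp_fv \<psi>"
| "pp_fv (Ex x \<phi>) = pp_fv \<phi> - {x}"

primrec pp_sat :: "('s, 'a) struc \<Rightarrow> (nat \<Rightarrow> 'a) \<Rightarrow> 's pp \<Rightarrow> bool" where
  "pp_sat A e Bot \<longleftrightarrow> False"
| "pp_sat A e (Eq x y) \<longleftrightarrow> e x = e y"
| "pp_sat A e (Rel s xs) \<longleftrightarrow> map e xs \<in> interp A s"
| "pp_sat A e (And \<phi> \<psi>) \<longleftrightarrow> pp_sat A e \<phi> \<and> pp_sat A e \<psi>"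
| "pp_sat A e (Ex x \<phi>) \<longleftrightarrow> (\<exists>a \<in> universe A. pp_sat A (e(x := a)) \<phi>)"

text \<open>
  The free variables are among \<open>0, \<dots>, m - 1\<close>, so the values of \<open>(!) xs\<close> beyond the length \<open>m\<close>
  of \<open>xs\<close> are irrelevant.
\<close>

definition pp_definable :: "('s, 'a) struc \<Rightarrow> nat \<Rightarrow> 'a list set \<Rightarrow> bool" where
  "pp_definable A m R \<longleftrightarrow>
     (\<exists>\<phi>. pp_wf (arity A) \<phi> \<and> pp_fv \<phi> \<subseteq> {..<m} \<and>
          R = {xs \<in> tuples (universe A) m. pp_sat A ((!) xs) \<phi>})"

text \<open>
  \<open>concat\<close> turns a \<open>k\<close>-tuple of \<open>n\<close>-tuples into the corresponding \<open>k * n\<close>-tuple.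
\<close>

definition is_pp_power :: "('s, 'a) struc \<Rightarrow> ('t, 'b) struc \<Rightarrow> bool" where
  "is_pp_power A B \<longleftrightarrow>
     (\<exists>n \<ge> 1. \<exists>C :: ('t, 'a list) struc.
        is_struc C \<and> universe C = tuples (universe A) n \<and>
        (\<forall>s. pp_definable A (arity C s * n) (concat ` interp C s)) \<and>
        isomorphic C B)"

text \<open>
  Every pp-power of \<open>A\<close> is isomorphic to one over the type \<open>'a list\<close>, so the restriction to this
  type in the existential quantifier is harmless.
\<close>

definition pp_le :: "('s, 'a) struc \<Rightarrow> ('t, 'b) struc \<Rightarrow> bool" where
  "pp_le A B \<longleftrightarrow> (\<exists>P :: ('t, 'a list) struc. is_pp_power A P \<and> hom_equivalent P B)"

definition pp_class :: "('s, 'a) struc \<Rightarrow> ('s, 'a) struc set" where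
  "pp_class A = {B. is_struc B \<and> pp_le A B \<and> pp_le B A}"

definition class_le :: "('s, 'a) struc set \<Rightarrow> ('s, 'a) struc set \<Rightarrow> bool" where
  "class_le X Y \<longleftrightarrow> (\<exists>A \<in> X. \<exists>B \<in> Y. pp_le A B)"


section \<open>Polymorphisms\<close>

definition direct_power :: "('s, 'a) struc \<Rightarrow> nat \<Rightarrow> ('s, 'a list) struc" where
  "direct_power A k =
     \<lparr> universe = tuples (universe A) k,
       arity = arity A,
       interp = (\<lambda>s. {ts \<in> tuples (tuples (universe A) k) (arity A s).
                        \<forall>i < k. map (\<lambda>t. t ! i) ts \<in> interp A s}) \<rparr>"

definition has_quasi_maltsev :: "('s, 'a) struc \<Rightarrow> bool" where
  "has_quasi_maltsev A \<longleftrightarrow>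
     (\<exists>f. is_hom f (direct_power A 3) A \<and>
          (\<forall>x \<in> universe A. \<forall>y \<in> universe A.
             f [y, y, x] = f [x, x, x] \<and> f [x, x, x] = f [x, y, y]))"


section \<open>Digraphs\<close>

type_synonym 'a digraph = "(unit, 'a) struc"

definition edge :: "'a digraph \<Rightarrow> 'a \<Rightarrow> 'a \<Rightarrow> bool" where
  "edge G x y \<longleftrightarrow> [x, y] \<in> interp G ()"

definition finite_digraph :: "'a digraph \<Rightarrow> bool" where
  "finite_digraph G \<longleftrightarrow> is_struc G \<and> arity G () = 2 \<and> finite (universe G)"

definition make_digraph :: "'a set \<Rightarrow> ('a \<times> 'a) set \<Rightarrow> 'a digraph" where
  "make_digraph V E = \<lparr> universe = V, arity = (\<lambda>_. 2), interp = (\<lambda>_. {[x, y] | x y. (x, y) \<in> E}) \<rparr>"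

definition union_of_cycles :: "'a digraph \<Rightarrow> bool" where
  "union_of_cycles G \<longleftrightarrow>
     finite_digraph G \<and>
     (\<forall>v \<in> universe G. (\<exists>!u. edge G u v) \<and> (\<exists>!w. edge G v w))"

definition P1 :: "nat digraph" where
  "P1 = make_digraph {0, 1} {(0, 1)}"

definition C1 :: "nat digraph" where
  "C1 = make_digraph {0} {(0, 0)}"

text \<open>
  Every finite digraph is isomorphic to one whose vertices are natural numbers, so up to
  isomorphism nothing is lost by using such digraphs as the representatives of the elements.
\<close>

definition Poset_Digraphs :: "nat digraph set set" where
  "Poset_Digraphs = {pp_class G | G. finite_digraph G}"

definition Poset_Malt :: "nat digraph set set" where
  "Poset_Malt = {pp_class G | G. finite_digraph G \<and> has_quasi_maltsev G}"

definition Poset_UC :: "nat digraph set set" where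
  "Poset_UC = {pp_class C | C. union_of_cycles C}"


section \<open>Posets\<close>

definition order_iso ::
  "('x \<Rightarrow> 'y) \<Rightarrow> 'x set \<Rightarrow> ('x \<Rightarrow> 'x \<Rightarrow> bool) \<Rightarrow> 'y set \<Rightarrow> ('y \<Rightarrow> 'y \<Rightarrow> bool) \<Rightarrow> bool" where
  "order_iso f A le B le' \<longleftrightarrow>
     bij_betw f A B \<and> (\<forall>x \<in> A. \<forall>y \<in> A. le x y \<longleftrightarrow> le' (f x) (f y))"

text \<open>Pairs \<open>(x, y)\<close> such that \<open>x\<close> is a lower cover of \<open>y\<close>.\<close>

definition covering :: "'x set \<Rightarrow> ('x \<Rightarrow> 'x \<Rightarrow> bool) \<Rightarrow> ('x \<times> 'x) set" where
  "covering A le =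
     {(x, y). x \<in> A \<and> y \<in> A \<and> le x y \<and> x \<noteq> y \<and>
              \<not> (\<exists>z \<in> A. z \<noteq> x \<and> z \<noteq> y \<and> le x z \<and> le z y)}"

text \<open>
  The order on \<open>insert p A\<close>, for a new element \<open>p\<close>, in which \<open>p\<close> is placed immediately below \<open>t\<close>
  and above everything that is strictly below \<open>t\<close>.
\<close>

definition insert_below :: "('x \<Rightarrow> 'x \<Rightarrow> bool) \<Rightarrow> 'x \<Rightarrow> 'x \<Rightarrow> 'x \<Rightarrow> 'x \<Rightarrow> bool" where
  "insert_below le p t x y \<longleftrightarrow>
     (if x = p then y = p \<or> le t y
      else if y = p then le x t \<and> x \<noteq> t
      else le x y)"

lemma insert_below_unique_lower_cover:
  assumes refl: "\<And>x. x \<in> A \<Longrightarrow> le x x"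
    and antisym: "\<And>x y. \<lbrakk>x \<in> A; y \<in> A; le x y; le y x\<rbrakk> \<Longrightarrow> x = y"
    and "t \<in> A" "p \<notin> A"
  shows "(x, t) \<in> covering (insert p A) (insert_below le p t) \<longleftrightarrow> x = p"
  using assms unfolding covering_def insert_below_def by auto

end

theory Submission
  imports Defs
begin

text \<open>
  Polymorphisms of a structure act coordinatewise on its pp-powers and transfer along homomorphic
  equivalence, so the identities between minors of a polymorphism are preserved upwards. Hence the
  Maltsev digraphs form an up-set among all digraphs, and covers in the two posets agree.

  On a Maltsev digraph, a suitable retract has all relations \<open>E ^^ k\<close> rectangular. Identifying
  vertices with the same successors and deleting sinks preserves this property and shortens directed
  paths by one edge, while leaving permutations unchanged; so the digraph is homomorphically
  equivalent to a directed path or to a union of cycles. A path is equivalent to \<open>C1\<close> or \<open>P1\<close>.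

  Every loopless digraph with an edge pp-constructs \<open>P1\<close>. Conversely, \<open>P1\<close> has totally symmetric
  polymorphisms of all arities, so a union of cycles that it pp-constructs has a loop, and is
  therefore equivalent to \<open>C1\<close>.
\<close>

section \<open>Expressibility by primitive positive formulas\<close>

text \<open>The retract is taken because a quasi Maltsev operation need not be idempotent, and
  rectangularity comes out of a polymorphism only when \<open>m a b b = a\<close> and
  \<open>m c c d = d\<close> hold exactly. Rectangularity is required of all powers of
  \<open>E\<close> because the quotient shifts the exponent: an endpoint of a walk in the quotient
  is known only up to having the same successors, and one more edge is needed to exploit this, so
  exponent \<open>k\<close> in the quotient uses exponent \<open>k + 1\<close> in \<open>E\<close>.
  The reduction stops making progress only when there are no sinks and no two vertices share a
  successor; finiteness then turns the edge relation into a permutation. As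
  \<open>pp_class P1\<close> is itself an element of \<open>Poset_Malt\<close>, the required
  isomorphism is the identity. What has to be shown is that \<open>P1\<close> lies below a union of
  cycles exactly when \<open>C1\<close> does, and above it exactly when \<open>C1\<close> does not
  lie below it.\<close>

lemma finite_pp_fv: "finite (pp_fv \<phi>)"
  by (induction \<phi>) auto

lemma pp_sat_cong:
  "(\<And>x. x \<in> pp_fv \<phi> \<Longrightarrow> e x = e' x) \<Longrightarrow> pp_sat A e \<phi> = pp_sat A e' \<phi>"
proof (induction \<phi> arbitrary: e e')
  case (Rel s xs)
  then have "map e xs = map e' xs" by simp
  then show ?case by (metis pp_sat.simps(3))
next
  case (And \<phi> \<psi>)
  then show ?case by (metis UnCI pp_fv.simps(4) pp_sat.simps(4))
next
  case (Ex x \<phi>)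
  have "pp_sat A (e(x := a)) \<phi> = pp_sat A (e'(x := a)) \<phi>" for a
    by (rule Ex.IH) (use Ex.prems in auto)
  then show ?case by simp
qed auto

text \<open>A semantic form of definability: environments are total and the free variables are
  unrestricted, so closure properties can be chained without writing formulas.
  \<open>pp_expr_imp_definable\<close> returns to \<open>pp_definable\<close>.\<close>

definition pp_expr :: "('s, 'a) struc \<Rightarrow> ((nat \<Rightarrow> 'a) \<Rightarrow> bool) \<Rightarrow> bool" where
  "pp_expr A P \<longleftrightarrow>
     (\<exists>\<phi>. pp_wf (arity A) \<phi> \<and> (\<forall>e. range e \<subseteq> universe A \<longrightarrow> pp_sat A e \<phi> = P e))"

lemma pp_exprI:
  assumes "pp_wf (arity A) \<phi>" "\<And>e. range e \<subseteq> universe A \<Longrightarrow> pp_sat A e \<phi> = P e"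
  shows "pp_expr A P"
  using assms unfolding pp_expr_def by blast

lemma pp_expr_cong:
  assumes "pp_expr A P" "\<And>e. range e \<subseteq> universe A \<Longrightarrow> P e = Q e"
  shows "pp_expr A Q"
  using assms unfolding pp_expr_def by metis

lemma pp_expr_False: "pp_expr A (\<lambda>e. False)"
  by (rule pp_exprI[of _ Bot]) auto

lemma pp_expr_eq: "pp_expr A (\<lambda>e. e x = e y)"
  by (rule pp_exprI[of _ "Eq x y"]) auto

lemma pp_expr_True: "pp_expr A (\<lambda>e. True)"
  by (rule pp_exprI[of _ "Eq 0 0"]) auto

lemma pp_expr_rel: "length xs = arity A s \<Longrightarrow> pp_expr A (\<lambda>e. map e xs \<in> interp A s)"
  by (rule pp_exprI[of _ "Rel s xs"]) auto

lemma pp_expr_conj: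
  assumes "pp_expr A P" "pp_expr A Q"
  shows "pp_expr A (\<lambda>e. P e \<and> Q e)"
proof -
  obtain \<phi> \<psi> where "pp_wf (arity A) \<phi>" "\<forall>e. range e \<subseteq> universe A \<longrightarrow> pp_sat A e \<phi> = P e"
    "pp_wf (arity A) \<psi>" "\<forall>e. range e \<subseteq> universe A \<longrightarrow> pp_sat A e \<psi> = Q e"
    using assms unfolding pp_expr_def by blast
  then show ?thesis by (intro pp_exprI[of _ "And \<phi> \<psi>"]) auto
qed

lemma pp_expr_all_less:
  "(\<And>i. i < n \<Longrightarrow> pp_expr A (P i)) \<Longrightarrow> pp_expr A (\<lambda>e. \<forall>i < (n::nat). P i e)"
proof (induction n)
  case 0
  then show ?case by (simp add: pp_expr_True)
next
  case (Suc n)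
  have "pp_expr A (\<lambda>e. (\<forall>i < n. P i e) \<and> P n e)"
    by (intro pp_expr_conj Suc) (use Suc.prems in auto)
  then show ?case by (rule pp_expr_cong) (auto simp: less_Suc_eq)
qed

lemma pp_expr_ex:
  assumes "pp_expr A P"
  shows "pp_expr A (\<lambda>e. \<exists>a \<in> universe A. P (e(x := a)))"
proof -
  obtain \<phi> where \<phi>: "pp_wf (arity A) \<phi>" "\<And>e. range e \<subseteq> universe A \<Longrightarrow> pp_sat A e \<phi> = P e"
    using assms unfolding pp_expr_def by blast
  show ?thesis
  proof (rule pp_exprI[of _ "Ex x \<phi>"])
    fix e :: "nat \<Rightarrow> _" assume "range e \<subseteq> universe A"
    then have "range (e(x := a)) \<subseteq> universe A" if "a \<in> universe A" for a
      using that by auto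
    then show "pp_sat A e (Ex x \<phi>) = (\<exists>a \<in> universe A. P (e(x := a)))"
      using \<phi>(2) by auto
  qed (use \<phi>(1) in simp)
qed

text \<open>Quantifying a whole block of variables at once is what one quantifier over an
  \<open>n\<close>-dimensional power amounts to in the base structure.\<close>

lemma pp_expr_ex_finite:
  assumes "finite X" "pp_expr A P"
  shows "pp_expr A (\<lambda>e. \<exists>e'. range e' \<subseteq> universe A \<and> (\<forall>i. i \<notin> X \<longrightarrow> e' i = e i) \<and> P e')"
  using assms
proof (induction X)
  case empty
  show ?case
  proof (rule pp_expr_cong[OF empty.prems])
    fix e :: "nat \<Rightarrow> _" assume "range e \<subseteq> universe A"
    moreover have "e' = e" if "\<forall>i. i \<notin> {} \<longrightarrow> e' i = e i" for e' using that by auto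
    ultimately show "P e = (\<exists>e'. range e' \<subseteq> universe A \<and> (\<forall>i. i \<notin> {} \<longrightarrow> e' i = e i) \<and> P e')"
      by metis
  qed
next
  case (insert x X)
  show ?case
  proof (rule pp_expr_cong[OF pp_expr_ex[OF insert.IH[OF insert.prems], where x = x]])
    fix e :: "nat \<Rightarrow> _" assume e: "range e \<subseteq> universe A"
    show "(\<exists>a \<in> universe A. \<exists>e'. range e' \<subseteq> universe A \<and>
             (\<forall>i. i \<notin> X \<longrightarrow> e' i = (e(x := a)) i) \<and> P e') =
          (\<exists>e'. range e' \<subseteq> universe A \<and> (\<forall>i. i \<notin> insert x X \<longrightarrow> e' i = e i) \<and> P e')"
      (is "?l = ?r")
    proof
      assume ?l
      then obtain a e' where "range e' \<subseteq> universe A" "\<forall>i. i \<notin> X \<longrightarrow> e' i = (e(x := a)) i" "P e'"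
        by blast
      then show ?r by (intro exI[of _ e']) auto
    next
      assume ?r
      then obtain e' where e': "range e' \<subseteq> universe A" "\<forall>i. i \<notin> insert x X \<longrightarrow> e' i = e i" "P e'"
        by blast
      then have "e' x \<in> universe A" "\<forall>i. i \<notin> X \<longrightarrow> e' i = (e(x := e' x)) i" by auto
      then show ?l using e' by blast
    qed
  qed
qed

lemma pp_rename:
  "pp_wf ar \<phi> \<Longrightarrow> \<exists>\<psi>. pp_wf ar \<psi> \<and> (\<forall>e. pp_sat A e \<psi> = pp_sat A (e \<circ> r) \<phi>)"
proof (induction \<phi> arbitrary: r)
  case Bot
  then show ?case by (intro exI[of _ Bot]) simp
next
  case (Eq x y)
  then show ?case by (intro exI[of _ "Eq (r x) (r y)"]) simp
next
  case (Rel s xs)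
  then show ?case by (intro exI[of _ "Rel s (map r xs)"]) (simp add: comp_def)
next
  case (And \<phi>1 \<phi>2)
  then obtain \<psi>1 \<psi>2 where "pp_wf ar \<psi>1" "\<forall>e. pp_sat A e \<psi>1 = pp_sat A (e \<circ> r) \<phi>1"
    "pp_wf ar \<psi>2" "\<forall>e. pp_sat A e \<psi>2 = pp_sat A (e \<circ> r) \<phi>2"
    by (metis pp_wf.simps(4))
  then show ?case by (intro exI[of _ "And \<psi>1 \<psi>2"]) (simp add: comp_def)
next
  case (Ex x \<phi>)
  \<comment> \<open>\<open>r\<close> need not be injective, so the bound variable moves to a
    \<open>y\<close> outside the image of the free variables; otherwise it could capture one of
    them.\<close>
  obtain y where y: "y \<notin> r ` pp_fv \<phi>"
    using ex_new_if_finite[OF infinite_UNIV_nat] finite_pp_fv[of \<phi>] by blast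
  obtain \<psi> where \<psi>: "pp_wf ar \<psi>" "\<And>e. pp_sat A e \<psi> = pp_sat A (e \<circ> r(x := y)) \<phi>"
    using Ex.IH[of "r(x := y)"] Ex.prems by (metis pp_wf.simps(5))
  have *: "pp_sat A (e(y := a) \<circ> r(x := y)) \<phi> = pp_sat A ((e \<circ> r)(x := a)) \<phi>" for e a
    by (rule pp_sat_cong) (use y in auto)
  show ?case by (intro exI[of _ "Ex y \<psi>"]) (auto simp only: pp_wf.simps pp_sat.simps \<psi> *)
qed

lemma pp_expr_rename:
  assumes "pp_expr A P"
  shows "pp_expr A (\<lambda>e. P (e \<circ> r))"
proof -
  obtain \<phi> where \<phi>: "pp_wf (arity A) \<phi>" "\<And>e. range e \<subseteq> universe A \<Longrightarrow> pp_sat A e \<phi> = P e"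
    using assms unfolding pp_expr_def by blast
  obtain \<psi> where \<psi>: "pp_wf (arity A) \<psi>" "\<forall>e. pp_sat A e \<psi> = pp_sat A (e \<circ> r) \<phi>"
    using pp_rename[OF \<phi>(1)] by blast
  show ?thesis
  proof (rule pp_exprI[OF \<psi>(1)])
    fix e :: "nat \<Rightarrow> _" assume "range e \<subseteq> universe A"
    then have "range (e \<circ> r) \<subseteq> universe A" by auto
    then show "pp_sat A e \<psi> = P (e \<circ> r)" using \<phi>(2) \<psi>(2) by metis
  qed
qed

lemma map_in_tuples: "range e \<subseteq> A \<Longrightarrow> length xs = n \<Longrightarrow> map e xs \<in> tuples A n"
  unfolding tuples_def by auto

lemma pp_definable_imp_expr:
  assumes "pp_definable A m R" "length vs = m"
  shows "pp_expr A (\<lambda>e. map e vs \<in> R)"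
proof -
  obtain \<phi> where \<phi>: "pp_wf (arity A) \<phi>" "pp_fv \<phi> \<subseteq> {..<m}"
    "R = {xs \<in> tuples (universe A) m. pp_sat A ((!) xs) \<phi>}"
    using assms(1) unfolding pp_definable_def by blast
  have *: "pp_expr A (\<lambda>e. map e [0..<m] \<in> R)"
  proof (rule pp_exprI[OF \<phi>(1)])
    fix e :: "nat \<Rightarrow> _" assume "range e \<subseteq> universe A"
    then have "map e [0..<m] \<in> tuples (universe A) m" by (simp add: map_in_tuples)
    moreover have "pp_sat A ((!) (map e [0..<m])) \<phi> = pp_sat A e \<phi>"
      by (rule pp_sat_cong) (use \<phi>(2) in auto)
    ultimately show "pp_sat A e \<phi> = (map e [0..<m] \<in> R)" using \<phi>(3) by auto
  qed
  have eq: "map (e \<circ> (!) vs) [0..<m] = map e vs" for e :: "nat \<Rightarrow> _"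
    using assms(2) by (metis map_map map_nth)
  show ?thesis using pp_expr_rename[OF *, of "(!) vs"] unfolding eq .
qed

text \<open>The given formula may have free variables from \<open>m\<close> on. Its truth value
  depends on the first \<open>m\<close> values only, so quantifying the others existentially changes
  nothing, any element of the nonempty universe being a witness.\<close>

lemma pp_expr_imp_definable:
  assumes "pp_expr A (\<lambda>e. map e [0..<m] \<in> R)" "R \<subseteq> tuples (universe A) m" "universe A \<noteq> {}"
  shows "pp_definable A m R"
proof -
  obtain \<phi> where \<phi>: "pp_wf (arity A) \<phi>"
    "\<And>e. range e \<subseteq> universe A \<Longrightarrow> pp_sat A e \<phi> = (map e [0..<m] \<in> R)"
    using assms(1) unfolding pp_expr_def by blast
  have dep: "(map e [0..<m] \<in> R) = (map e' [0..<m] \<in> R)" if "\<And>x. x < m \<Longrightarrow> e x = e' x" for e e' :: "nat \<Rightarrow> _"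
    proof -
    have "map e [0..<m] = map e' [0..<m]" using that by simp
    then show ?thesis by (rule arg_cong)
  qed
  define ys where "ys = sorted_list_of_set (pp_fv \<phi> - {..<m})"
  have ys: "set ys = pp_fv \<phi> - {..<m}" by (simp add: ys_def finite_pp_fv)
  have close: "pp_wf (arity A) (fold Ex zs \<chi>) \<and> pp_fv (fold Ex zs \<chi>) = pp_fv \<chi> - set zs \<and>
      (\<forall>e. range e \<subseteq> universe A \<longrightarrow> pp_sat A e (fold Ex zs \<chi>) = (map e [0..<m] \<in> R))"
    if "pp_wf (arity A) \<chi>" "\<forall>z \<in> set zs. m \<le> z"
      "\<And>e. range e \<subseteq> universe A \<Longrightarrow> pp_sat A e \<chi> = (map e [0..<m] \<in> R)" for zs \<chi>
    using that
  proof (induction zs arbitrary: \<chi>)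
    case (Cons z zs)
    have "pp_sat A e (Ex z \<chi>) = (map e [0..<m] \<in> R)" if e: "range e \<subseteq> universe A" for e
    proof -
      have "pp_sat A (e(z := a)) \<chi> = (map e [0..<m] \<in> R)" if "a \<in> universe A" for a
      proof -
        have "range (e(z := a)) \<subseteq> universe A" using e that by auto
        moreover have "(map (e(z := a)) [0..<m] \<in> R) = (map e [0..<m] \<in> R)"
          by (rule dep) (use Cons.prems(2) in auto)
        ultimately show ?thesis using Cons.prems(3) by blast
      qed
      then show ?thesis using assms(3) by auto
    qed
    then have "pp_wf (arity A) (fold Ex zs (Ex z \<chi>)) \<and>
        pp_fv (fold Ex zs (Ex z \<chi>)) = pp_fv (Ex z \<chi>) - set zs \<and>
      (\<forall>e. range e \<subseteq> universe A \<longrightarrow> pp_sat A e (fold Ex zs (Ex z \<chi>)) = (map e [0..<m] \<in> R))"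
    proof (intro Cons.IH)
      show "pp_wf (arity A) (Ex z \<chi>)" using Cons.prems(1) by simp
      show "\<forall>z \<in> set zs. m \<le> z" using Cons.prems(2) by simp
    qed
    then show ?case by auto
  qed simp
  define \<psi> where "\<psi> = fold Ex ys \<phi>"
  have \<psi>: "pp_wf (arity A) \<psi>" "pp_fv \<psi> \<subseteq> {..<m}"
    "\<And>e. range e \<subseteq> universe A \<Longrightarrow> pp_sat A e \<psi> = (map e [0..<m] \<in> R)"
    using close[of \<phi> ys] \<phi> ys unfolding \<psi>_def by auto
  obtain a where a: "a \<in> universe A" using assms(3) by blast
  have "pp_sat A ((!) xs) \<psi> = (xs \<in> R)" if xs: "xs \<in> tuples (universe A) m" for xs
  proof -
    \<comment> \<open>Padding by \<open>a\<close> keeps all values in the universe, whereas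
      \<open>(!) xs\<close> is unspecified beyond \<open>m\<close>.\<close>
    define e where "e = (\<lambda>i. if i < m then xs ! i else a)"
    have e: "range e \<subseteq> universe A" "map e [0..<m] = xs"
      using xs a unfolding e_def tuples_def by (auto intro!: nth_equalityI)
    have "pp_sat A ((!) xs) \<psi> = pp_sat A e \<psi>"
      by (rule pp_sat_cong) (use \<psi>(2) in \<open>auto simp: e_def\<close>)
    then show ?thesis using \<psi>(3) e by simp
  qed
  then have "R = {xs \<in> tuples (universe A) m. pp_sat A ((!) xs) \<psi>}" using assms(2) by auto
  then show ?thesis unfolding pp_definable_def using \<psi> by blast
qed

section \<open>Composition of pp-powers\<close>

lemma inj_on_concat_tuples: "inj_on concat (tuples (tuples A n) m)"
proof (rule inj_onI)
  fix xs ys assume xs: "xs \<in> tuples (tuples A n) m" and ys: "ys \<in> tuples (tuples A n) m"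
    and eq: "concat xs = concat ys"
  have "length x = length y" if "(x, y) \<in> set (zip xs ys)" for x y
    using set_zip_leftD[OF that] set_zip_rightD[OF that] xs ys unfolding tuples_def by auto
  then show "xs = ys"
    using eq xs ys by (intro concat_injective) (auto simp: tuples_def)
qed

lemma concat_map_upt: "concat (map (\<lambda>i. [i * n..<i * n + n]) [0..<m]) = [0..<m * n]"
proof (induction m)
  case (Suc m)
  then show ?case using upt_add_eq_append[of 0 "m * n" n] by (simp add: add.commute)
qed simp

lemma concat_map_concat: "concat (map concat xsss) = concat (concat xsss)"
  by (induction xsss) auto

lemma concat_in_tuples: "xs \<in> tuples (tuples A n) m \<Longrightarrow> concat xs \<in> tuples A (m * n)"
proof (induction xs arbitrary: m)
  case (Cons x xs)
  then obtain k where m: "m = Suc k" by (cases m) (auto simp: tuples_def)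
  then have "concat xs \<in> tuples A (k * n)" using Cons by (auto simp: tuples_def)
  then show ?case using Cons.prems m by (auto simp: tuples_def)
qed (auto simp: tuples_def)

lemma concat_image_tuples: "concat ` tuples (tuples A n) m = tuples A (m * n)"
proof
  show "tuples A (m * n) \<subseteq> concat ` tuples (tuples A n) m"
  proof
    fix xs assume xs: "xs \<in> tuples A (m * n)"
    define ts where "ts = map (\<lambda>i. map ((!) xs) [i * n..<i * n + n]) [0..<m]"
    have "concat ts = map ((!) xs) (concat (map (\<lambda>i. [i * n..<i * n + n]) [0..<m]))"
      unfolding ts_def by (simp add: map_concat comp_def)
    then have "concat ts = xs"
      using xs by (simp only: concat_map_upt) (metis (mono_tags, lifting) map_nth mem_Collect_eq tuples_def)
    moreover have "i * n + n \<le> m * n" if "i < m" for i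
      using that by (metis Suc_leI add.commute mult_Suc mult_le_mono1)
    then have "ts \<in> tuples (tuples A n) m"
      using xs unfolding ts_def tuples_def by (fastforce simp: set_conv_nth)
    ultimately show "xs \<in> concat ` tuples (tuples A n) m" by blast
  qed
qed (use concat_in_tuples in blast)

lemma map_in_tuples_image: "xs \<in> tuples A n \<Longrightarrow> f ` A \<subseteq> B \<Longrightarrow> map f xs \<in> tuples B n"
  unfolding tuples_def by auto

lemma tuples_nonempty: "A \<noteq> {} \<Longrightarrow> tuples A n \<noteq> {}"
  unfolding tuples_def by (metis (mono_tags, lifting) empty_Collect_eq ex_in_conv in_set_replicate
      length_replicate subsetI)

lemma interp_tuples: "is_struc A \<Longrightarrow> t \<in> interp A s \<Longrightarrow> t \<in> tuples (universe A) (arity A s)"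
  unfolding is_struc_def by blast

lemma is_hom_comp: "is_hom f A B \<Longrightarrow> is_hom g B C \<Longrightarrow> is_hom (g \<circ> f) A C"
  unfolding is_hom_def by (simp add: image_subset_iff) (metis map_map)

lemma hom_equivalent_sym: "hom_equivalent A B \<Longrightarrow> hom_equivalent B A"
  unfolding hom_equivalent_def by blast

lemma hom_equivalent_trans:
  "hom_equivalent A B \<Longrightarrow> hom_equivalent B C \<Longrightarrow> hom_equivalent A C"
  unfolding hom_equivalent_def using is_hom_comp by metis

lemma hom_pp_sat: "is_hom f A B \<Longrightarrow> pp_sat A e \<phi> \<Longrightarrow> pp_sat B (f \<circ> e) \<phi>"
proof (induction \<phi> arbitrary: e)
  case (Rel s xs)
  then have "map f (map e xs) \<in> interp B s" unfolding is_hom_def by (simp del: map_map)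
  then show ?case by (simp add: comp_def)
next
  case (Ex x \<phi>)
  then obtain a where a: "a \<in> universe A" "pp_sat A (e(x := a)) \<phi>" by auto
  then have "pp_sat B (f \<circ> e(x := a)) \<phi>" using Ex by blast
  moreover have "f a \<in> universe B" using a Ex.prems unfolding is_hom_def by auto
  ultimately show ?case unfolding fun_upd_comp pp_sat.simps by blast
qed auto

text \<open>The witness inside \<open>is_pp_power\<close>, taken before passing to an isomorphic
  copy and with its dimension exposed.\<close>

definition concrete_pp_power :: "('s, 'a) struc \<Rightarrow> nat \<Rightarrow> ('t, 'a list) struc \<Rightarrow> bool" where
  "concrete_pp_power A n C \<longleftrightarrow>
     n \<ge> 1 \<and> is_struc C \<and> universe C = tuples (universe A) n \<and>
     (\<forall>s. pp_definable A (arity C s * n) (concat ` interp C s))"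

lemma concrete_pp_powerD:
  assumes "concrete_pp_power A n C"
  shows "n \<ge> 1" "is_struc C" "universe C = tuples (universe A) n"
    "pp_definable A (arity C s * n) (concat ` interp C s)"
  using assms unfolding concrete_pp_power_def by blast+

lemma concrete_pp_power_universe_nonempty:
  "concrete_pp_power A n C \<Longrightarrow> universe A \<noteq> {}"
  unfolding concrete_pp_power_def is_struc_def tuples_def
  by (cases n) (auto simp: length_Suc_conv)

text \<open>The isomorphism in the definition of a pp-power is absorbed by homomorphic equivalence.
  The inverse isomorphism acts correctly on images of tuples of \<open>B\<close> because those
  tuples have their entries in the universe.\<close>

lemma pp_le_iff:
  fixes A :: "('s, 'a) struc" and B :: "('t, 'b) struc"
  assumes B: "is_struc B"
  shows "pp_le A B \<longleftrightarrow> (\<exists>n C. concrete_pp_power A n C \<and> hom_equivalent C B)"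
proof
  assume "pp_le A B"
  then obtain P :: "('t, 'a list) struc" and n C where n: "n \<ge> 1" and C: "is_struc C"
    "universe C = tuples (universe A) n"
    "\<forall>s. pp_definable A (arity C s * n) (concat ` interp C s)" and
    iso: "isomorphic C P" and PB: "hom_equivalent P B"
    unfolding pp_le_def is_pp_power_def by blast
  obtain f where ar: "arity C = arity P" and f: "bij_betw f (universe C) (universe P)"
    "\<forall>s. \<forall>t \<in> tuples (universe C) (arity C s). t \<in> interp C s \<longleftrightarrow> map f t \<in> interp P s"
    using iso unfolding isomorphic_def by blast
  obtain g h where g: "is_hom g P B" and h: "is_hom h B P"
    using PB unfolding hom_equivalent_def by blast
  have "is_hom f C P"
    unfolding is_hom_def using ar f interp_tuples[OF C(1)] by (auto simp: bij_betw_def)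
  then have "is_hom (g \<circ> f) C B" using g by (rule is_hom_comp)
  moreover have "is_hom (inv_into (universe C) f \<circ> h) B C"
  proof -
    let ?i = "inv_into (universe C) f \<circ> h"
    have hU: "h ` universe B \<subseteq> f ` universe C"
      using h f(1) unfolding is_hom_def bij_betw_def by auto
    then have iU: "?i ` universe B \<subseteq> universe C" by (auto intro!: inv_into_into)
    have "map ?i t \<in> interp C s" if t: "t \<in> interp B s" for s t
    proof -
      have tB: "t \<in> tuples (universe B) (arity C s)"
        using interp_tuples[OF B t] ar h unfolding is_hom_def by simp
      then have "map f (map ?i t) = map h t"
        using hU by (auto simp: tuples_def intro!: f_inv_into_f)
      moreover have "map h t \<in> interp P s" using h t unfolding is_hom_def by blast
      ultimately show ?thesis using f(2) map_in_tuples_image[OF tB iU] by metis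
    qed
    then show ?thesis using iU ar h unfolding is_hom_def by simp
  qed
  ultimately show "\<exists>n C. concrete_pp_power A n C \<and> hom_equivalent C B"
    using n C unfolding concrete_pp_power_def hom_equivalent_def by blast
next
  assume "\<exists>n C. concrete_pp_power A n C \<and> hom_equivalent C B"
  then obtain n and C :: "('t, 'a list) struc" where
    nC: "concrete_pp_power A n C" "hom_equivalent C B" by blast
  have "isomorphic C C" unfolding isomorphic_def by (auto intro!: exI[of _ id])
  then have "is_pp_power A C" using nC(1) unfolding is_pp_power_def concrete_pp_power_def by blast
  then show "pp_le A B" using nC(2) unfolding pp_le_def by blast
qed

text \<open>Variable \<open>x\<close> over the power becomes the block of \<open>n\<close> base
  variables starting at \<open>x * n\<close>. Equalities and quantifiers are translated blockwise,
  and a relation symbol is replaced by the formula defining its flattened relation.\<close>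

lemma pp_expr_in_power:
  assumes C: "concrete_pp_power A n C" and "pp_wf (arity C) \<phi>"
  shows "pp_expr A (\<lambda>e. pp_sat C (\<lambda>x. map e [x * n..<x * n + n]) \<phi>)"
  using assms(2)
proof (induction \<phi>)
  case Bot
  then show ?case by (simp add: pp_expr_False)
next
  case (Eq x y)
  have "pp_expr A (\<lambda>e. \<forall>i < n. e (x * n + i) = e (y * n + i))"
    by (intro pp_expr_all_less pp_expr_eq)
  then show ?case by (rule pp_expr_cong) (auto simp: list_eq_iff_nth_eq)
next
  case (Rel s xs)
  have U: "universe C = tuples (universe A) n" and st: "is_struc C"
    using C unfolding concrete_pp_power_def by auto
  have *: "map e (concat (map (\<lambda>x. [x * n..<x * n + n]) xs)) =
      concat (map (\<lambda>x. map e [x * n..<x * n + n]) xs)" for e :: "nat \<Rightarrow> _"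
    by (simp add: map_concat comp_def)
  have "length (concat (map (\<lambda>x. [x * n..<x * n + n]) xs)) = arity C s * n"
    using Rel by (simp add: length_concat comp_def sum_list_triv)
  then have "pp_expr A (\<lambda>e. map e (concat (map (\<lambda>x. [x * n..<x * n + n]) xs)) \<in> concat ` interp C s)"
    using C by (intro pp_definable_imp_expr) (auto simp: concrete_pp_power_def)
  then show ?case
  proof (rule pp_expr_cong)
    fix e :: "nat \<Rightarrow> _" assume "range e \<subseteq> universe A"
    then have t: "map (\<lambda>x. map e [x * n..<x * n + n]) xs \<in> tuples (tuples (universe A) n) (arity C s)"
      using Rel U by (auto simp: tuples_def image_subset_iff)
    have "interp C s \<subseteq> tuples (tuples (universe A) n) (arity C s)"
      using st U unfolding is_struc_def by simp
    from inj_on_image_mem_iff[OF inj_on_concat_tuples t this]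
    show "(map e (concat (map (\<lambda>x. [x * n..<x * n + n]) xs)) \<in> concat ` interp C s) =
      pp_sat C (\<lambda>x. map e [x * n..<x * n + n]) (Rel s xs)"
      unfolding * pp_sat.simps .
  qed
next
  case (And \<phi>1 \<phi>2)
  then show ?case by (simp add: pp_expr_conj)
next
  case (Ex x \<phi>)
  let ?X = "{x * n..<x * n + n}" and ?d = "\<lambda>e x. map e [x * n..<x * n + n]"
  have n: "n \<ge> 1" and U: "universe C = tuples (universe A) n"
    using C unfolding concrete_pp_power_def by auto
  \<comment> \<open>Distinct blocks are disjoint, since division by \<open>n\<close> recovers the
    variable; hence changing block \<open>x\<close> does not affect the values of other
    variables.\<close>
  have block: "i \<notin> ?X" if "y \<noteq> x" "y * n \<le> i" "i < y * n + n" for i y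
  proof
    assume "i \<in> ?X"
    then have "i div n = x" "i div n = y"
      using that by (auto intro!: div_nat_eqI simp: mult.commute add.commute)
    then show False using that by simp
  qed
  have IH: "pp_expr A (\<lambda>e. pp_sat C (?d e) \<phi>)" using Ex by simp
  show ?case
  proof (rule pp_expr_cong[OF pp_expr_ex_finite[OF _ IH, of ?X]])
    fix e :: "nat \<Rightarrow> _" assume e: "range e \<subseteq> universe A"
    show "(\<exists>e'. range e' \<subseteq> universe A \<and> (\<forall>i. i \<notin> ?X \<longrightarrow> e' i = e i) \<and> pp_sat C (?d e') \<phi>) =
        pp_sat C (?d e) (Ex x \<phi>)" (is "?l = ?r")
    proof
      assume ?l
      then obtain e' where e': "range e' \<subseteq> universe A" "\<forall>i. i \<notin> ?X \<longrightarrow> e' i = e i"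
        "pp_sat C (?d e') \<phi>" by blast
      have "?d e' y = ((?d e)(x := ?d e' x)) y" for y
        using block[of y] e'(2) by (cases "y = x") auto
      then have eq: "?d e' = (?d e)(x := ?d e' x)" by blast
      have "pp_sat C ((?d e)(x := ?d e' x)) \<phi>" using e'(3) unfolding eq[symmetric] .
      moreover have "?d e' x \<in> universe C" unfolding U using e'(1) by (simp add: map_in_tuples)
      ultimately show ?r unfolding pp_sat.simps by blast
    next
      assume ?r
      then obtain a where a: "a \<in> universe C" "pp_sat C ((?d e)(x := a)) \<phi>" by auto
      define e' where "e' = (\<lambda>i. if i \<in> ?X then a ! (i - x * n) else e i)"
      have la: "length a = n" "set a \<subseteq> universe A" using a U unfolding tuples_def by auto
      then have "a ! (i - x * n) \<in> universe A" if "i \<in> ?X" for i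
        using that by (auto intro!: subsetD[OF la(2)] nth_mem)
      then have "range e' \<subseteq> universe A" using e unfolding e'_def by auto
      moreover have "?d e' y = ((?d e)(x := a)) y" for y
        using block[of y] la by (cases "y = x") (auto simp: e'_def intro!: nth_equalityI)
      then have eq: "?d e' = (?d e)(x := a)" by blast
      have "pp_sat C (?d e') \<phi>" using a(2) unfolding eq .
      moreover have "\<forall>i. i \<notin> ?X \<longrightarrow> e' i = e i" unfolding e'_def by simp
      ultimately show ?l by blast
    qed
  qed simp
qed

lemma pp_definable_in_power:
  assumes C: "concrete_pp_power A n C" and R: "pp_definable C m R"
  shows "pp_definable A (m * n) (concat ` R)"
proof -
  have U: "universe C = tuples (universe A) n" using C unfolding concrete_pp_power_def by blast
  obtain \<phi> where \<phi>: "pp_wf (arity C) \<phi>" "pp_fv \<phi> \<subseteq> {..<m}"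
    "R = {xs \<in> tuples (universe C) m. pp_sat C ((!) xs) \<phi>}"
    using R unfolding pp_definable_def by blast
  show ?thesis
  proof (rule pp_expr_imp_definable)
    show "concat ` R \<subseteq> tuples (universe A) (m * n)"
      using concat_in_tuples \<phi>(3) U by auto
    show "universe A \<noteq> {}" using C by (rule concrete_pp_power_universe_nonempty)
    show "pp_expr A (\<lambda>e. map e [0..<m * n] \<in> concat ` R)"
    proof (rule pp_expr_cong[OF pp_expr_in_power[OF C \<phi>(1)]])
      fix e :: "nat \<Rightarrow> _" assume e: "range e \<subseteq> universe A"
      let ?t = "map (\<lambda>x. map e [x * n..<x * n + n]) [0..<m]"
      have "concat ?t = map e (concat (map (\<lambda>i. [i * n..<i * n + n]) [0..<m]))"
        by (simp add: map_concat comp_def)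
      then have t: "concat ?t = map e [0..<m * n]" by (simp only: concat_map_upt)
      have tm: "?t \<in> tuples (tuples (universe A) n) m" using e by (auto simp: tuples_def image_subset_iff)
      have "R \<subseteq> tuples (tuples (universe A) n) m" using \<phi>(3) U by auto
      from inj_on_image_mem_iff[OF inj_on_concat_tuples tm this]
      have "map e [0..<m * n] \<in> concat ` R \<longleftrightarrow> ?t \<in> R" unfolding t .
      also have "\<dots> \<longleftrightarrow> pp_sat C ((!) ?t) \<phi>" using \<phi>(3) tm U by auto
      also have "\<dots> \<longleftrightarrow> pp_sat C (\<lambda>x. map e [x * n..<x * n + n]) \<phi>"
        by (rule pp_sat_cong) (use \<phi>(2) in auto)
      finally show "pp_sat C (\<lambda>x. map e [x * n..<x * n + n]) \<phi> = (map e [0..<m * n] \<in> concat ` R)"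
        by simp
    qed
  qed
qed

text \<open>An \<open>m\<close>-tuple of \<open>n\<close>-tuples is flattened to an
  \<open>m * n\<close>-tuple. \<open>concat\<close> is injective on tuples of this shape, so
  \<open>concat\<close> and its inverse are homomorphisms between \<open>D\<close> and the flattened
  structure.\<close>

lemma concrete_pp_power_trans:
  assumes C: "concrete_pp_power A n C" and D: "concrete_pp_power C m D"
  shows "\<exists>F. concrete_pp_power A (m * n) F \<and> hom_equivalent F D"
proof -
  let ?F = "\<lparr>universe = concat ` universe D, arity = arity D,
             interp = \<lambda>s. map concat ` interp D s\<rparr>"
  have U: "universe C = tuples (universe A) n" and V: "universe D = tuples (universe C) m"
    and mn: "m \<ge> 1" "n \<ge> 1" and st: "is_struc D"
    using concrete_pp_powerD[OF C] concrete_pp_powerD[OF D] by simp_all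
  have n: "m * n \<ge> 1" using mn by (simp add: Suc_le_eq)
  have inj: "inj_on concat (universe D)" unfolding V U by (rule inj_on_concat_tuples)
  have "is_hom concat D ?F" unfolding is_hom_def by simp
  moreover have "is_hom (inv_into (universe D) concat) ?F D"
  proof -
    have "map (inv_into (universe D) concat) (map concat t) = t" if "t \<in> interp D s" for s t
    proof -
      have "set t \<subseteq> universe D" using interp_tuples[OF st that] unfolding tuples_def by simp
      then have "map (\<lambda>x. inv_into (universe D) concat (concat x)) t = t"
        using inj by (intro map_idI) (simp add: subset_iff)
      then show ?thesis by (simp add: comp_def)
    qed
    then have "\<forall>t \<in> interp ?F s. map (inv_into (universe D) concat) t \<in> interp D s" for s
      by fastforce
    moreover have "inv_into (universe D) concat ` universe ?F \<subseteq> universe D"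
      using inj by (simp add: image_subset_iff)
    ultimately show ?thesis unfolding is_hom_def by simp
  qed
  moreover have "concrete_pp_power A (m * n) ?F"
  proof -
    have "is_struc ?F"
      using st unfolding is_struc_def by (auto intro!: map_in_tuples_image)
    moreover have "concat ` universe D = tuples (universe A) (m * n)"
      unfolding U V by (rule concat_image_tuples)
    moreover have "pp_definable A (arity D s * (m * n)) (concat ` map concat ` interp D s)" for s
    proof -
      have "pp_definable C (arity D s * m) (concat ` interp D s)"
        using D unfolding concrete_pp_power_def by blast
      from pp_definable_in_power[OF C this] show ?thesis
        by (simp only: image_image concat_map_concat mult.assoc)
    qed
    ultimately show ?thesis using n unfolding concrete_pp_power_def by simp
  qed
  ultimately show ?thesis unfolding hom_equivalent_def
    by (intro exI[of _ ?F] conjI exI) assumption+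
qed

text \<open>Homomorphisms preserve pp-formulas, so the same formulas interpreted in \<open>A\<close>
  and in \<open>B\<close> yield structures related by \<open>map f\<close>.\<close>

lemma concrete_pp_power_hom:
  assumes AB: "is_hom f A B" and D: "universe D = tuples (universe A) m" "arity D = ar"
      "\<And>s. interp D s = {ts \<in> tuples (tuples (universe A) m) (ar s). pp_sat A ((!) (concat ts)) (\<phi> s)}"
    and E: "universe E = tuples (universe B) m" "arity E = ar"
      "\<And>s. interp E s = {ts \<in> tuples (tuples (universe B) m) (ar s). pp_sat B ((!) (concat ts)) (\<phi> s)}"
    and fv: "\<And>s. pp_fv (\<phi> s) \<subseteq> {..<ar s * m}"
  shows "is_hom (map f) D E"
proof -
  have f: "f ` universe A \<subseteq> universe B" using AB unfolding is_hom_def by blast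
  have "map (map f) ts \<in> interp E s" if ts: "ts \<in> interp D s" for s ts
  proof -
    have t: "ts \<in> tuples (tuples (universe A) m) (ar s)" "pp_sat A ((!) (concat ts)) (\<phi> s)"
      using ts D by auto
    have "length (concat ts) = ar s * m"
      using concat_in_tuples[OF t(1)] unfolding tuples_def by simp
    then have "pp_sat B ((!) (map f (concat ts))) (\<phi> s) = pp_sat B (f \<circ> (!) (concat ts)) (\<phi> s)"
      by (intro pp_sat_cong) (use fv[of s] in auto)
    then have "pp_sat B ((!) (concat (map (map f) ts))) (\<phi> s)"
      using hom_pp_sat[OF AB t(2)] by (simp add: map_concat)
    moreover have "map f ` tuples (universe A) m \<subseteq> tuples (universe B) m"
      using f map_in_tuples_image by blast
    ultimately show ?thesis unfolding E(3) using map_in_tuples_image[OF t(1)] by blast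
  qed
  moreover have "map f ` universe D \<subseteq> universe E"
    unfolding D E(1) using map_in_tuples_image[OF _ f] by blast
  ultimately show ?thesis unfolding is_hom_def D(2) E(2) by simp
qed

text \<open>The formulas that define \<open>E\<close> over \<open>B\<close> are reused over
  \<open>A\<close>; the two homomorphisms between \<open>A\<close> and \<open>B\<close> then act
  entrywise.\<close>

lemma concrete_pp_power_hom_equivalent:
  assumes AB: "hom_equivalent A B" and E: "concrete_pp_power B m E" and A: "is_struc A"
  shows "\<exists>D. concrete_pp_power A m D \<and> hom_equivalent D E"
proof -
  have st: "is_struc E" and U: "universe E = tuples (universe B) m" and m: "m \<ge> 1"
    and def: "pp_definable B (arity E s * m) (concat ` interp E s)" for s
    using E unfolding concrete_pp_power_def by auto
  have ar: "arity A = arity B" using AB unfolding hom_equivalent_def is_hom_def by blast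
  have "\<forall>s. \<exists>\<phi>. pp_wf (arity B) \<phi> \<and> pp_fv \<phi> \<subseteq> {..<arity E s * m} \<and> concat ` interp E s =
      {xs \<in> tuples (universe B) (arity E s * m). pp_sat B ((!) xs) \<phi>}"
    using def unfolding pp_definable_def by blast
  from choice[OF this] obtain \<phi> where \<phi>: "\<And>s. pp_wf (arity B) (\<phi> s)"
    "\<And>s. pp_fv (\<phi> s) \<subseteq> {..<arity E s * m}"
    "\<And>s. concat ` interp E s =
      {xs \<in> tuples (universe B) (arity E s * m). pp_sat B ((!) xs) (\<phi> s)}" by blast
  have intE: "interp E s =
    {ts \<in> tuples (tuples (universe B) m) (arity E s). pp_sat B ((!) (concat ts)) (\<phi> s)}" for s
  proof -
    have sub: "interp E s \<subseteq> tuples (tuples (universe B) m) (arity E s)"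
      using st U unfolding is_struc_def by metis
    have "ts \<in> interp E s \<longleftrightarrow> pp_sat B ((!) (concat ts)) (\<phi> s)"
      if "ts \<in> tuples (tuples (universe B) m) (arity E s)" for ts
      using inj_on_image_mem_iff[OF inj_on_concat_tuples that sub] \<phi>(3)[of s]
        concat_in_tuples[OF that] by simp
    then show ?thesis using sub by blast
  qed
  let ?D = "\<lparr>universe = tuples (universe A) m, arity = arity E, interp = \<lambda>s.
    {ts \<in> tuples (tuples (universe A) m) (arity E s). pp_sat A ((!) (concat ts)) (\<phi> s)}\<rparr>"
  obtain f g where f: "is_hom f A B" and g: "is_hom g B A"
    using AB unfolding hom_equivalent_def by blast
  have "is_struc ?D"
    using A tuples_nonempty[of "universe A" m] unfolding is_struc_def by auto
  moreover have "is_hom (map f) ?D E"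
    by (rule concrete_pp_power_hom[where \<phi> = \<phi>, OF f _ _ _ _ _ _ \<phi>(2)]) (simp_all add: U intE)
  moreover have "is_hom (map g) E ?D"
    by (rule concrete_pp_power_hom[where \<phi> = \<phi>, OF g _ _ _ _ _ _ \<phi>(2)]) (simp_all add: U intE)
  moreover have "pp_definable A (arity E s * m) (concat ` interp ?D s)" for s
  proof -
    have "concat ` interp ?D s = {xs \<in> tuples (universe A) (arity E s * m). pp_sat A ((!) xs) (\<phi> s)}"
      unfolding concat_image_tuples[symmetric] by auto
    then show ?thesis unfolding pp_definable_def using \<phi> ar by metis
  qed
  ultimately show ?thesis using m unfolding concrete_pp_power_def hom_equivalent_def by fastforce
qed

section \<open>The quasi-order \<open>pp_le\<close>\<close>

lemma pp_le_hom_equivalent: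
  assumes "is_struc B" "is_struc C" "pp_le A B" "hom_equivalent B C"
  shows "pp_le A C"
  using assms hom_equivalent_trans unfolding pp_le_iff[OF assms(1)] pp_le_iff[OF assms(2)] by blast

text \<open>The power \<open>Q\<close> of \<open>B\<close> is first moved to the structure
  \<open>P\<close>, homomorphically equivalent to \<open>B\<close>; the resulting power of a power
  of \<open>A\<close> is then flattened.\<close>

lemma pp_le_trans:
  assumes "is_struc B" "is_struc C" "pp_le A B" "pp_le B C"
  shows "pp_le A C"
proof -
  obtain n P where P: "concrete_pp_power A n P" "hom_equivalent P B"
    using assms pp_le_iff by blast
  obtain m Q where Q: "concrete_pp_power B m Q" "hom_equivalent Q C"
    using assms pp_le_iff by blast
  obtain R where R: "concrete_pp_power P m R" "hom_equivalent R Q"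
    using concrete_pp_power_hom_equivalent[OF P(2) Q(1)] P(1) unfolding concrete_pp_power_def by blast
  obtain F where F: "concrete_pp_power A (m * n) F" "hom_equivalent F R"
    using concrete_pp_power_trans[OF P(1) R(1)] by blast
  have "hom_equivalent F C"
    by (rule hom_equivalent_trans[OF F(2) hom_equivalent_trans[OF R(2) Q(2)]])
  then show ?thesis unfolding pp_le_iff[OF assms(2)] using F(1) by blast
qed

lemma pp_le_refl:
  assumes A: "is_struc A"
  shows "pp_le A A"
proof -
  let ?C = "\<lparr>universe = tuples (universe A) 1, arity = arity A,
             interp = \<lambda>s. map (\<lambda>a. [a]) ` interp A s\<rparr>"
  have U: "tuples (universe A) 1 = (\<lambda>a. [a]) ` universe A"
    unfolding tuples_def by (auto simp: length_Suc_conv)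
  have "is_struc ?C"
    using A unfolding is_struc_def U by (auto intro!: map_in_tuples_image)
  moreover have "pp_definable A (arity A s * 1) (concat ` map (\<lambda>a. [a]) ` interp A s)" for s
  proof -
    have *: "concat ` map (\<lambda>a. [a]) ` interp A s = interp A s" by (simp add: image_image)
    show ?thesis unfolding * mult_1_right
      by (rule pp_expr_imp_definable[OF pp_expr_rel])
        (use A in \<open>auto simp: is_struc_def\<close>)
  qed
  ultimately have "concrete_pp_power A 1 ?C" unfolding concrete_pp_power_def by simp
  moreover have "is_hom (\<lambda>a. [a]) A ?C" unfolding is_hom_def U by auto
  moreover have "is_hom hd ?C A" unfolding is_hom_def U by (auto simp: comp_def)
  ultimately show ?thesis unfolding pp_le_iff[OF A] hom_equivalent_def by blast
qed

section \<open>Polymorphisms along pp-constructions\<close>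

text \<open>Witnesses of a quantifier are chosen in each coordinate and assembled into a tuple.
  Positivity of \<open>k\<close> serves \<open>Bot\<close>: with no coordinates the last hypothesis
  would hold vacuously.\<close>

lemma pp_sat_direct_power:
  assumes "k > 0" "pp_wf (arity A) \<phi>" "range e \<subseteq> tuples (universe A) k"
    "\<And>i. i < k \<Longrightarrow> pp_sat A (\<lambda>x. e x ! i) \<phi>"
  shows "pp_sat (direct_power A k) e \<phi>"
  using assms(2-)
proof (induction \<phi> arbitrary: e)
  case Bot
  then show ?case using assms(1) by auto
next
  case (Eq x y)
  then have "length (e x) = k" "length (e y) = k"
    unfolding tuples_def by (auto simp: image_subset_iff)
  then show ?case using Eq by (auto intro: nth_equalityI)
next
  case (Rel s xs)
  then have "map e xs \<in> tuples (tuples (universe A) k) (arity A s)" by (simp add: map_in_tuples)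
  then show ?case using Rel by (auto simp: direct_power_def comp_def)
next
  case (And \<phi>1 \<phi>2)
  then show ?case by simp
next
  case (Ex x \<phi>)
  have "\<forall>i. \<exists>a. i < k \<longrightarrow> a \<in> universe A \<and> pp_sat A ((\<lambda>x. e x ! i)(x := a)) \<phi>"
    using Ex.prems(3) by auto
  from choice[OF this] obtain a where
    a: "\<And>i. i < k \<Longrightarrow> a i \<in> universe A" "\<And>i. i < k \<Longrightarrow> pp_sat A ((\<lambda>x. e x ! i)(x := a i)) \<phi>"
    by blast
  let ?b = "map a [0..<k]"
  have b: "?b \<in> tuples (universe A) k" using a(1) unfolding tuples_def by auto
  have "pp_sat (direct_power A k) (e(x := ?b)) \<phi>"
  proof (rule Ex.IH)
    show "pp_wf (arity A) \<phi>" using Ex.prems(1) by simp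
    show "range (e(x := ?b)) \<subseteq> tuples (universe A) k" using Ex.prems(2) b by auto
    fix i assume i: "i < k"
    have "(\<lambda>y. (e(x := ?b)) y ! i) = (\<lambda>x. e x ! i)(x := a i)" using i by auto
    then show "pp_sat A (\<lambda>y. (e(x := ?b)) y ! i) \<phi>" using a(2)[OF i] by metis
  qed
  then show ?case using b by (auto simp: direct_power_def)
qed

text \<open>This is the preservation of pp-definable relations by polymorphisms: the members of
  \<open>ts\<close> are rows, and \<open>f\<close> is applied to the columns. The columns form an
  environment in the direct power, which \<open>f\<close> maps back to \<open>A\<close>.\<close>

lemma polymorphism_definable:
  assumes R: "pp_definable A m R" and f: "is_hom f (direct_power A k) A" and k: "k > 0"
    and ts: "ts \<in> tuples R k" and A: "universe A \<noteq> {}"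
  shows "map (\<lambda>j. f (map (\<lambda>t. t ! j) ts)) [0..<m] \<in> R"
proof -
  obtain a where a: "a \<in> universe A" using A by blast
  obtain \<phi> where \<phi>: "pp_wf (arity A) \<phi>" "pp_fv \<phi> \<subseteq> {..<m}"
    "R = {xs \<in> tuples (universe A) m. pp_sat A ((!) xs) \<phi>}"
    using R unfolding pp_definable_def by blast
  define e where "e = (\<lambda>j. if j < m then map (\<lambda>t. t ! j) ts else replicate k a)"
  have lts: "length ts = k" and tR: "\<And>t. t \<in> set ts \<Longrightarrow> t \<in> R" using ts unfolding tuples_def by auto
  have ek: "range e \<subseteq> tuples (universe A) k"
  proof -
    have "t ! j \<in> universe A" if "t \<in> set ts" "j < m" for t j
    proof -
      have "length t = m" "set t \<subseteq> universe A" using tR[OF that(1)] \<phi>(3) unfolding tuples_def by auto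
      then show ?thesis using nth_mem that(2) by blast
    qed
    then show ?thesis using lts a unfolding e_def tuples_def by auto
  qed
  have "pp_sat (direct_power A k) e \<phi>"
  proof (rule pp_sat_direct_power[OF k \<phi>(1) ek])
    fix i assume "i < k"
    then have "ts ! i \<in> R" using lts tR by simp
    then have "pp_sat A ((!) (ts ! i)) \<phi>" using \<phi>(3) by simp
    also have "pp_sat A ((!) (ts ! i)) \<phi> = pp_sat A (\<lambda>x. e x ! i) \<phi>"
      by (rule pp_sat_cong) (use \<phi>(2) \<open>i < k\<close> lts in \<open>auto simp: e_def\<close>)
    finally show "pp_sat A (\<lambda>x. e x ! i) \<phi>" .
  qed
  from hom_pp_sat[OF f this] have "pp_sat A (f \<circ> e) \<phi>" .
  also have "pp_sat A (f \<circ> e) \<phi> = pp_sat A ((!) (map (f \<circ> e) [0..<m])) \<phi>"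
    by (rule pp_sat_cong) (use \<phi>(2) in auto)
  finally have "pp_sat A ((!) (map (f \<circ> e) [0..<m])) \<phi>" .
  moreover have "range (f \<circ> e) \<subseteq> universe A"
    using ek f unfolding is_hom_def direct_power_def by (auto simp: image_subset_iff)
  then have "map (f \<circ> e) [0..<m] \<in> tuples (universe A) m" by (intro map_in_tuples) auto
  ultimately have "map (f \<circ> e) [0..<m] \<in> R" using \<phi>(3) by blast
  moreover have "map (f \<circ> e) [0..<m] = map (\<lambda>j. f (map (\<lambda>t. t ! j) ts)) [0..<m]"
    by (simp add: e_def)
  ultimately show ?thesis by simp
qed

lemma nth_concat_tuples:
  "xs \<in> tuples (tuples A n) m \<Longrightarrow> q < m \<Longrightarrow> p < n \<Longrightarrow> concat xs ! (q * n + p) = xs ! q ! p"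
proof (induction xs arbitrary: m q)
  case (Cons x xs)
  then obtain k where k: "m = Suc k" "xs \<in> tuples (tuples A n) k" "length x = n"
    by (cases m) (auto simp: tuples_def)
  then show ?case using Cons.IH[of k] Cons.prems by (cases q) (auto simp: nth_append)
qed (auto simp: tuples_def)

lemma map_nth_concat_blocks:
  "map g [0..<m * n] = concat (map (\<lambda>q. map (\<lambda>p. g (q * n + p)) [0..<n]) [0..<m])"
proof -
  have "map (\<lambda>p. g (q * n + p)) [0..<n] = map g [q * n..<q * n + n]" for q
    by (rule nth_equalityI) auto
  then have "concat (map (\<lambda>q. map (\<lambda>p. g (q * n + p)) [0..<n]) [0..<m]) =
      map g (concat (map (\<lambda>i. [i * n..<i * n + n]) [0..<m]))"
    by (simp add: map_concat comp_def)
  then show ?thesis by (simp only: concat_map_upt)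
qed

lemma polymorphism_concrete_pp_power:
  assumes C: "concrete_pp_power A n C" and f: "is_hom f (direct_power A k) A" and k: "k > 0"
  shows "is_hom (\<lambda>ts. map (\<lambda>j. f (map (\<lambda>t. t ! j) ts)) [0..<n]) (direct_power C k) C"
    (is "is_hom ?F _ _")
proof -
  have U: "universe C = tuples (universe A) n" and st: "is_struc C"
    using concrete_pp_powerD[OF C] by blast+
  have fU: "f xs \<in> universe A" if "xs \<in> tuples (universe A) k" for xs
    using f that unfolding is_hom_def direct_power_def by auto
  have FU: "?F ts \<in> tuples (universe A) n" if "ts \<in> tuples (tuples (universe A) n) k" for ts
  proof -
    have "map (\<lambda>t. t ! j) ts \<in> tuples (universe A) k" if "j < n" for j
      using \<open>ts \<in> _\<close> that unfolding tuples_def by fastforce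
    then show ?thesis using fU unfolding tuples_def[of _ n] by auto
  qed
  have "map ?F T \<in> interp C s" if T: "T \<in> interp (direct_power C k) s" for T s
  proof -
    let ?m = "arity C s"
    have T1: "T \<in> tuples (tuples (tuples (universe A) n) k) ?m"
      and T2: "\<And>i. i < k \<Longrightarrow> map (\<lambda>t. t ! i) T \<in> interp C s"
      using T U by (auto simp: direct_power_def)
    have sub: "interp C s \<subseteq> tuples (tuples (universe A) n) ?m"
      using st U unfolding is_struc_def by metis
    \<comment> \<open>Row \<open>i\<close> flattens the \<open>i\<close>-th projection of
      \<open>T\<close>, a tuple of the relation in \<open>C\<close>; this puts the problem over
      \<open>A\<close>, where definability applies.\<close>
    let ?rs = "map (\<lambda>i. concat (map (\<lambda>t. t ! i) T)) [0..<k]"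
    have "?rs \<in> tuples (concat ` interp C s) k" using T2 unfolding tuples_def by auto
    from polymorphism_definable[OF concrete_pp_powerD(4)[OF C] f k this
        concrete_pp_power_universe_nonempty[OF C]]
    have R: "map (\<lambda>j. f (map (\<lambda>t. t ! j) ?rs)) [0..<?m * n] \<in> concat ` interp C s" .
    have "map (\<lambda>p. f (map (\<lambda>t. t ! (q * n + p)) ?rs)) [0..<n] = ?F (T ! q)" if q: "q < ?m" for q
    proof -
      have "length T = ?m" using T1 unfolding tuples_def by simp
      moreover have "T ! q \<in> tuples (tuples (universe A) n) k"
        using T1 q unfolding tuples_def[of _ ?m] by (simp add: subset_iff)
      ultimately have lT: "length T = ?m" "length (T ! q) = k"
        unfolding tuples_def by simp_all
      have "map (\<lambda>t. t ! (q * n + p)) ?rs = map (\<lambda>t. t ! p) (T ! q)" if p: "p < n" for p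
      proof (rule nth_equalityI)
        fix i assume "i < length (map (\<lambda>t. t ! (q * n + p)) ?rs)"
        then have i: "i < k" by simp
        have "concat (map (\<lambda>t. t ! i) T) ! (q * n + p) = map (\<lambda>t. t ! i) T ! q ! p"
          by (rule nth_concat_tuples[OF subsetD[OF sub T2[OF i]] q p])
        then show "map (\<lambda>t. t ! (q * n + p)) ?rs ! i = map (\<lambda>t. t ! p) (T ! q) ! i"
          using i lT q by simp
      qed (use lT in simp)
      then show ?thesis by simp
    qed
    then have "map (\<lambda>j. f (map (\<lambda>t. t ! j) ?rs)) [0..<?m * n] = concat (map (\<lambda>q. ?F (T ! q)) [0..<?m])"
      unfolding map_nth_concat_blocks by (intro arg_cong[of _ _ concat] map_cong) auto
    also have "map (\<lambda>q. ?F (T ! q)) [0..<?m] = map ?F T"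
      using T1 unfolding tuples_def by (intro nth_equalityI) auto
    finally have "concat (map ?F T) \<in> concat ` interp C s" using R by (simp only:)
    moreover have "map ?F T \<in> tuples (tuples (universe A) n) ?m"
      using T1 by (rule map_in_tuples_image) (use FU in blast)
    ultimately show ?thesis
      using inj_on_image_mem_iff[OF inj_on_concat_tuples _ sub] by blast
  qed
  moreover have "?F ` universe (direct_power C k) \<subseteq> universe C"
    using FU U by (auto simp: direct_power_def)
  moreover have "arity (direct_power C k) = arity C" by (simp add: direct_power_def)
  ultimately show ?thesis unfolding is_hom_def by blast
qed

lemma direct_power_hom:
  assumes g: "is_hom g B C"
  shows "is_hom (map g) (direct_power B k) (direct_power C k)"
proof -
  have gU: "g ` universe B \<subseteq> universe C" and ar: "arity B = arity C"
    and gR: "\<And>t s. t \<in> interp B s \<Longrightarrow> map g t \<in> interp C s" using g unfolding is_hom_def by blast+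
  have mU: "map g ` tuples (universe B) k \<subseteq> tuples (universe C) k"
    using map_in_tuples_image[OF _ gU] by blast
  have "map (map g) T \<in> interp (direct_power C k) s" if T: "T \<in> interp (direct_power B k) s" for T s
  proof -
    have T1: "T \<in> tuples (tuples (universe B) k) (arity B s)"
      and T2: "\<And>i. i < k \<Longrightarrow> map (\<lambda>t. t ! i) T \<in> interp B s"
      using T by (auto simp: direct_power_def)
    have "map (\<lambda>t. t ! i) (map (map g) T) = map g (map (\<lambda>t. t ! i) T)" if "i < k" for i
      using T1 that unfolding tuples_def by auto
    then have "\<forall>i < k. map (\<lambda>t. t ! i) (map (map g) T) \<in> interp C s" using gR T2 by metis
    then show ?thesis using map_in_tuples_image[OF T1 mU] ar by (simp add: direct_power_def)
  qed
  then show ?thesis using mU ar unfolding is_hom_def by (simp add: direct_power_def)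
qed

text \<open>The identity \<open>f \<circ> \<alpha> = f \<circ> \<beta>\<close> between minors of \<open>f\<close> in \<open>r\<close> variables is given by
  the lists \<open>\<alpha>\<close> and \<open>\<beta>\<close> of variable indices.\<close>

definition minor_identity :: "('a list \<Rightarrow> 'b) \<Rightarrow> 'a set \<Rightarrow> nat \<Rightarrow> nat list \<Rightarrow> nat list \<Rightarrow> bool" where
  "minor_identity f U r \<alpha> \<beta> \<longleftrightarrow>
     (\<forall>xs \<in> tuples U r. f (map ((!) xs) \<alpha>) = f (map ((!) xs) \<beta>))"

text \<open>\<open>F\<close> is the coordinatewise action of \<open>f\<close> placed between
  \<open>g\<close> and \<open>h\<close>. An identity with exactly one application of
  \<open>f\<close> on each side survives this; one with a bare variable on a side, such as
  idempotence, need not.\<close>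

lemma pp_le_polymorphism:
  assumes B: "is_struc B" and AB: "pp_le A B" and f: "is_hom f (direct_power A k) A" and k: "k > 0"
  obtains F where "is_hom F (direct_power B k) B"
    "\<And>r \<alpha> \<beta>. set \<alpha> \<union> set \<beta> \<subseteq> {..<r} \<Longrightarrow> minor_identity f (universe A) r \<alpha> \<beta> \<Longrightarrow>
       minor_identity F (universe B) r \<alpha> \<beta>"
proof -
  obtain n C where C: "concrete_pp_power A n C" "hom_equivalent C B"
    using AB pp_le_iff[OF B] by blast
  obtain g h where h: "is_hom h C B" and g: "is_hom g B C"
    using C(2) unfolding hom_equivalent_def by blast
  define F where "F = (\<lambda>ts. map (\<lambda>j. f (map (\<lambda>t. t ! j) ts)) [0..<n])"
  have "is_hom F (direct_power C k) C"
    unfolding F_def by (rule polymorphism_concrete_pp_power[OF C(1) f k])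
  then have "is_hom (h \<circ> (F \<circ> map g)) (direct_power B k) B"
    by (intro is_hom_comp[OF _ h] is_hom_comp[OF direct_power_hom[OF g]])
  moreover have "minor_identity (h \<circ> (F \<circ> map g)) (universe B) r \<alpha> \<beta>"
    if ab: "set \<alpha> \<union> set \<beta> \<subseteq> {..<r}" and mi: "minor_identity f (universe A) r \<alpha> \<beta>" for r \<alpha> \<beta>
  proof -
    have "F (map g (map ((!) xs) \<alpha>)) = F (map g (map ((!) xs) \<beta>))"
      if xs: "xs \<in> tuples (universe B) r" for xs
    proof -
      have gxs: "map g xs \<in> tuples (tuples (universe A) n) r"
        using map_in_tuples_image[OF xs] g concrete_pp_powerD(3)[OF C(1)]
        unfolding is_hom_def by metis
      have *: "f (map (\<lambda>t. t ! j) (map g (map ((!) xs) \<alpha>))) = f (map (\<lambda>t. t ! j) (map g (map ((!) xs) \<beta>)))"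
        if j: "j < n" for j
      proof -
        let ?ys = "map (\<lambda>x. g x ! j) xs"
        have "?ys \<in> tuples (universe A) r"
          using gxs j unfolding tuples_def by fastforce
        then have fab: "f (map ((!) ?ys) \<alpha>) = f (map ((!) ?ys) \<beta>)"
          using mi unfolding minor_identity_def by blast
        have eq: "map (\<lambda>t. t ! j) (map g (map ((!) xs) \<gamma>)) = map ((!) ?ys) \<gamma>"
          if "set \<gamma> \<subseteq> {..<r}" for \<gamma>
          using that xs unfolding tuples_def by auto
        have "set \<alpha> \<subseteq> {..<r}" "set \<beta> \<subseteq> {..<r}" using ab by auto
        then show ?thesis using fab by (simp only: eq)
      qed
      then show ?thesis unfolding F_def by (intro map_cong) auto
    qed
    then show ?thesis unfolding minor_identity_def by simp
  qed
  ultimately show thesis by (rule that)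
qed

lemma tuples_2: "tuples U 2 = {[x, y] | x y. x \<in> U \<and> y \<in> U}"
  unfolding tuples_def by (auto simp: length_Suc_conv numeral_2_eq_2)

text \<open>Index 0 stands for \<open>x\<close> and index 1 for \<open>y\<close>.\<close>

lemma quasi_maltsev_iff_minor_identities:
  "(\<forall>x \<in> U. \<forall>y \<in> U. f [y, y, x] = f [x, x, x] \<and> f [x, x, x] = f [x, y, y]) \<longleftrightarrow>
   minor_identity f U 2 [1, 1, 0] [0, 0, 0] \<and> minor_identity f U 2 [0, 0, 0] [0, 1, 1]"
proof -
  have "minor_identity f U 2 \<alpha> \<beta> \<longleftrightarrow>
      (\<forall>x \<in> U. \<forall>y \<in> U. f (map ((!) [x, y]) \<alpha>) = f (map ((!) [x, y]) \<beta>))" for \<alpha> \<beta>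
    unfolding minor_identity_def tuples_2 by blast
  then show ?thesis
    by (simp only: list.map nth_Cons_0 nth_Cons_Suc One_nat_def) blast
qed

lemma pp_le_quasi_maltsev:
  assumes B: "is_struc B" and AB: "pp_le A B" and A: "has_quasi_maltsev A"
  shows "has_quasi_maltsev B"
proof -
  obtain f where f: "is_hom f (direct_power A 3) A"
    "minor_identity f (universe A) 2 [1, 1, 0] [0, 0, 0]"
    "minor_identity f (universe A) 2 [0, 0, 0] [0, 1, 1]"
    using A unfolding has_quasi_maltsev_def quasi_maltsev_iff_minor_identities by blast
  obtain F where F: "is_hom F (direct_power B 3) B"
    "\<And>r \<alpha> \<beta>. set \<alpha> \<union> set \<beta> \<subseteq> {..<r} \<Longrightarrow> minor_identity f (universe A) r \<alpha> \<beta> \<Longrightarrow>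
       minor_identity F (universe B) r \<alpha> \<beta>"
    using pp_le_polymorphism[OF B AB f(1)] by auto
  have "minor_identity F (universe B) 2 [1, 1, 0] [0, 0, 0]"
    "minor_identity F (universe B) 2 [0, 0, 0] [0, 1, 1]"
    by (rule F(2)[OF _ f(2)], simp, rule F(2)[OF _ f(3)], simp)
  then show ?thesis
    unfolding has_quasi_maltsev_def quasi_maltsev_iff_minor_identities using F(1) by blast
qed

section \<open>Digraphs\<close>

definition digraph :: "'a digraph \<Rightarrow> bool" where
  "digraph G \<longleftrightarrow> is_struc G \<and> arity G () = 2"

lemma finite_digraph_iff: "finite_digraph G \<longleftrightarrow> digraph G \<and> finite (universe G)"
  unfolding finite_digraph_def digraph_def by blast

lemma digraph_interp:
  assumes "digraph G" "t \<in> interp G s"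
  obtains x y where "t = [x, y]" "edge G x y"
  using assms interp_tuples[of G t s] unfolding digraph_def edge_def by (auto simp: tuples_2)

lemma digraph_edge_universe:
  assumes "digraph G" "edge G x y"
  shows "x \<in> universe G" "y \<in> universe G"
  using assms interp_tuples[of G "[x, y]" "()"] unfolding digraph_def edge_def by (auto simp: tuples_2)

lemma digraph_universe_nonempty: "digraph G \<Longrightarrow> universe G \<noteq> {}"
  unfolding digraph_def is_struc_def by blast

lemma digraph_hom_iff:
  assumes G: "digraph G" and H: "digraph H"
  shows "is_hom f G H \<longleftrightarrow>
    f ` universe G \<subseteq> universe H \<and> (\<forall>x y. edge G x y \<longrightarrow> edge H (f x) (f y))"
proof -
  have "arity G = arity H" using G H unfolding digraph_def by (intro ext) simp
  moreover have "(\<forall>s. \<forall>t \<in> interp G s. map f t \<in> interp H s) \<longleftrightarrow>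
      (\<forall>x y. edge G x y \<longrightarrow> edge H (f x) (f y))" (is "?l \<longleftrightarrow> ?r")
  proof
    assume ?l
    then show ?r unfolding edge_def by fastforce
  next
    assume r: ?r
    show ?l
    proof (intro allI ballI)
      fix s t assume "t \<in> interp G s"
      then obtain x y where "t = [x, y]" "edge G x y" using digraph_interp[OF G] by blast
      then show "map f t \<in> interp H s" using r unfolding edge_def by simp
    qed
  qed
  ultimately show ?thesis unfolding is_hom_def by blast
qed

lemma edge_make_digraph [simp]: "edge (make_digraph V E) x y \<longleftrightarrow> (x, y) \<in> E"
  unfolding edge_def make_digraph_def by simp

lemma universe_make_digraph [simp]: "universe (make_digraph V E) = V"
  unfolding make_digraph_def by simp

lemma digraph_make_digraph: "V \<noteq> {} \<Longrightarrow> E \<subseteq> V \<times> V \<Longrightarrow> digraph (make_digraph V E)"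
  unfolding digraph_def is_struc_def make_digraph_def by (auto simp: tuples_2)

lemma digraph_direct_power:
  assumes "digraph G"
  shows "digraph (direct_power G k)"
  using assms tuples_nonempty[of "universe G" k]
  unfolding digraph_def is_struc_def direct_power_def by auto

lemma edge_direct_power:
  assumes "digraph G"
  shows "edge (direct_power G k) ts us \<longleftrightarrow>
    ts \<in> tuples (universe G) k \<and> us \<in> tuples (universe G) k \<and> (\<forall>i < k. edge G (ts ! i) (us ! i))"
  using assms unfolding digraph_def direct_power_def edge_def by (auto simp: tuples_2)

text \<open>The common pattern of the constructions below: \<open>E\<close> is the edge relation of
  an \<open>n\<close>-dimensional power, with the tail in the first \<open>n\<close> variables and
  the head in the next \<open>n\<close>, and \<open>f\<close>, \<open>g\<close> witness homomorphic
  equivalence with \<open>H\<close>.\<close>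

lemma pp_le_digraphI:
  assumes A: "universe A \<noteq> {}" and H: "digraph H" and n: "n \<ge> 1"
    and E: "E \<subseteq> tuples (universe A) n \<times> tuples (universe A) n"
    and expr: "pp_expr A (\<lambda>e. (map e [0..<n], map e [n..<n + n]) \<in> E)"
    and f: "\<And>x. x \<in> tuples (universe A) n \<Longrightarrow> f x \<in> universe H" "\<And>x y. (x, y) \<in> E \<Longrightarrow> edge H (f x) (f y)"
    and g: "\<And>x. x \<in> universe H \<Longrightarrow> g x \<in> tuples (universe A) n" "\<And>x y. edge H x y \<Longrightarrow> (g x, g y) \<in> E"
  shows "pp_le A H"
proof -
  let ?C = "make_digraph (tuples (universe A) n) E"
  have C: "digraph ?C" using tuples_nonempty[OF A] E by (intro digraph_make_digraph)
  have "pp_definable A (2 * n) (concat ` interp ?C s)" for s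
  proof (rule pp_expr_imp_definable[OF _ _ A])
    have eq: "concat ` interp ?C s = {x @ y | x y. (x, y) \<in> E}"
      unfolding make_digraph_def by force
    show "concat ` interp ?C s \<subseteq> tuples (universe A) (2 * n)"
      unfolding eq using E unfolding tuples_def by fastforce
    show "pp_expr A (\<lambda>e. map e [0..<2 * n] \<in> concat ` interp ?C s)"
    proof (rule pp_expr_cong[OF expr])
      fix e :: "nat \<Rightarrow> _" assume "range e \<subseteq> universe A"
      have len: "length x = n" if "(x, y) \<in> E" for x y using E that unfolding tuples_def by auto
      have "map e [0..<2 * n] = map e [0..<n] @ map e [n..<n + n]"
        using upt_add_eq_append[of 0 n n] by (simp add: mult_2)
      then show "((map e [0..<n], map e [n..<n + n]) \<in> E) = (map e [0..<2 * n] \<in> concat ` interp ?C s)"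
        unfolding eq using len by (auto simp: append_eq_append_conv)
    qed
  qed
  then have "concrete_pp_power A n ?C"
    using n C unfolding concrete_pp_power_def digraph_def by (simp add: make_digraph_def)
  moreover have "is_hom f ?C H" unfolding digraph_hom_iff[OF C H] using f by auto
  moreover have "is_hom g H ?C" unfolding digraph_hom_iff[OF H C] using g by auto
  ultimately show ?thesis
    using H pp_le_iff[of H A] unfolding digraph_def hom_equivalent_def by blast
qed

lemma hom_equivalent_pp_le:
  "is_struc A \<Longrightarrow> is_struc B \<Longrightarrow> hom_equivalent A B \<Longrightarrow> pp_le A B"
  using pp_le_hom_equivalent pp_le_refl by blast

section \<open>Comparisons with a single edge and a single loop\<close>

lemma digraph_P1: "digraph P1"
  unfolding P1_def by (rule digraph_make_digraph) auto

lemma edge_P1 [simp]: "edge P1 x y \<longleftrightarrow> x = 0 \<and> y = 1"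
  unfolding P1_def by simp

lemma universe_P1 [simp]: "universe P1 = {0, 1}"
  unfolding P1_def by simp

lemma digraph_C1: "digraph C1"
  unfolding C1_def by (rule digraph_make_digraph) auto

lemma edge_C1 [simp]: "edge C1 x y \<longleftrightarrow> x = 0 \<and> y = 0"
  unfolding C1_def by simp

lemma universe_C1 [simp]: "universe C1 = {0}"
  unfolding C1_def by simp

text \<open>The full binary relation on the first power has a loop and maps to \<open>C1\<close> by
  a constant.\<close>

lemma pp_le_C1:
  assumes "universe A \<noteq> {}"
  shows "pp_le A C1"
proof -
  obtain a where "a \<in> universe A" using assms by blast
  have expr: "pp_expr A (\<lambda>e. (map e [0..<1], map e [1..<1 + 1]) \<in> tuples (universe A) 1 \<times> tuples (universe A) 1)"
    by (rule pp_expr_cong[OF pp_expr_True]) (auto simp: tuples_def image_subset_iff)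
  show ?thesis
    by (rule pp_le_digraphI[OF assms digraph_C1 _ _ expr, where f = "\<lambda>_. 0" and g = "\<lambda>_. [a]"])
      (use \<open>a \<in> _\<close> in \<open>auto simp: tuples_def\<close>)
qed

lemma C1_le_loop:
  assumes "digraph G" "edge G a a"
  shows "pp_le C1 G"
proof -
  have "is_hom (\<lambda>_. a) C1 G" "is_hom (\<lambda>_. 0) G C1"
    using assms digraph_edge_universe[OF assms] by (auto simp: digraph_hom_iff digraph_C1)
  then show ?thesis
    using assms digraph_C1 unfolding digraph_def
    by (intro hom_equivalent_pp_le) (auto simp: hom_equivalent_def)
qed

text \<open>\<open>Bot\<close> is what defines the empty relation over \<open>C1\<close>; every
  formula without it holds there at the only vertex.\<close>

lemma C1_le_edgeless:
  assumes G: "digraph G" and "\<And>x y. \<not> edge G x y"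
  shows "pp_le C1 G"
proof -
  obtain a where "a \<in> universe G" using digraph_universe_nonempty[OF G] by blast
  have expr: "pp_expr C1 (\<lambda>e. (map e [0..<1], map e [1..<1 + 1]) \<in> {})"
    by (simp add: pp_expr_False)
  show ?thesis
    by (rule pp_le_digraphI[OF _ G _ _ expr, where f = "\<lambda>_. a" and g = "\<lambda>_. [0]"])
      (use \<open>a \<in> _\<close> assms in \<open>auto simp: tuples_def\<close>)
qed

text \<open>In the second pp-power, the edges run from the diagonal to the edge relation, and these
  two sets are disjoint.\<close>

lemma loopless_le_P1:
  assumes G: "digraph G" and ab: "edge G a b" and loopless: "\<And>x. \<not> edge G x x"
  shows "pp_le G P1"
proof -
  let ?E = "{([x, x], [y, z]) | x y z. x \<in> universe G \<and> edge G y z}"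
  have "arity G () = 2" using G unfolding digraph_def by blast
  then have "pp_expr G (\<lambda>e. e 0 = e 1 \<and> map e [2, 3] \<in> interp G ())"
    by (intro pp_expr_conj pp_expr_eq pp_expr_rel) simp
  then have expr: "pp_expr G (\<lambda>e. (map e [0..<2], map e [2..<2 + 2]) \<in> ?E)"
    by (rule pp_expr_cong) (auto simp: edge_def numeral_eq_Suc)
  show ?thesis
  proof (rule pp_le_digraphI[OF digraph_universe_nonempty[OF G] digraph_P1 _ _ expr,
      where f = "\<lambda>xs. if xs ! 0 = xs ! 1 then 0 else 1" and g = "\<lambda>i. if i = 0 then [a, a] else [a, b]"])
    show "?E \<subseteq> tuples (universe G) 2 \<times> tuples (universe G) 2"
      using digraph_edge_universe[OF G] by (auto simp: tuples_2)
    show "(if i = 0 then [a, a] else [a, b]) \<in> tuples (universe G) 2" for i :: nat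
      using digraph_edge_universe[OF G ab] by (auto simp: tuples_2)
    show "edge P1 (if xs ! 0 = xs ! 1 then 0 else 1) (if ys ! 0 = ys ! 1 then 0 else 1)"
      if "(xs, ys) \<in> ?E" for xs ys
      using that loopless by auto
  qed (use ab digraph_edge_universe[OF G ab] in auto)
qed

text \<open>\<open>C1\<close> has a constant unary polymorphism, which for a digraph with an edge requires a loop.\<close>

lemma not_C1_le_P1: "\<not> pp_le C1 P1"
proof
  assume le: "pp_le C1 P1"
  have f: "is_hom (\<lambda>_. 0) (direct_power C1 1) C1"
    by (auto simp: digraph_hom_iff digraph_C1 digraph_direct_power)
  have P1: "is_struc P1" using digraph_P1 unfolding digraph_def by blast
  obtain F where F: "is_hom F (direct_power P1 1) P1"
    and mi: "\<And>r \<alpha> \<beta>. set \<alpha> \<union> set \<beta> \<subseteq> {..<r} \<Longrightarrow>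
      minor_identity (\<lambda>_. 0::nat) (universe C1) r \<alpha> \<beta> \<Longrightarrow> minor_identity F (universe P1) r \<alpha> \<beta>"
    using pp_le_polymorphism[OF P1 le f] by auto
  have "minor_identity F (universe P1) 2 [0] [1]"
    by (rule mi) (auto simp: minor_identity_def)
  moreover have "[0, 1] \<in> tuples (universe P1) 2" by (simp add: tuples_2)
  ultimately have "F (map ((!) [0, 1]) [0]) = F (map ((!) [0, 1]) [1])"
    unfolding minor_identity_def by blast
  then have "F [0] = F [1]" by simp
  moreover have "edge (direct_power P1 1) [0] [1]"
    by (simp add: edge_direct_power digraph_P1 tuples_def)
  then have "edge P1 (F [0]) (F [1])"
    using F by (simp add: digraph_hom_iff digraph_P1 digraph_direct_power)
  ultimately show False by auto
qed

text \<open>\<open>P1\<close> has the totally symmetric polymorphism \<open>Min\<close> of every arity. Applied to a list of all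
  vertices of a union of cycles and to the list of their successors, which is a permutation of the
  first, it gives a loop.\<close>

lemma P1_le_union_of_cycles_loop:
  assumes G: "union_of_cycles G" and le: "pp_le P1 G"
  shows "\<exists>a. edge G a a"
proof -
  have dG: "digraph G" and fin: "finite (universe G)"
    using G unfolding union_of_cycles_def finite_digraph_iff by blast+
  obtain vs where vs: "set vs = universe G" and dist: "distinct vs"
    using finite_distinct_list[OF fin] by blast
  let ?k = "length vs"
  have k: "?k > 0" using vs digraph_universe_nonempty[OF dG] by auto
  define \<sigma> where "\<sigma> v = (THE w. edge G v w)" for v
  have \<sigma>: "edge G v (\<sigma> v)" if "v \<in> universe G" for v
    using G that theI'[of "edge G v"] unfolding union_of_cycles_def \<sigma>_def by blast
  have \<sigma>U: "\<sigma> v \<in> universe G" if "v \<in> universe G" for v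
    using digraph_edge_universe[OF dG \<sigma>[OF that]] by blast
  have "inj_on \<sigma> (universe G)"
    using G \<sigma> \<sigma>U unfolding union_of_cycles_def by (metis (no_types, lifting) inj_onI)
  then have surj: "\<sigma> ` universe G = universe G"
    using fin \<sigma>U by (intro endo_inj_surj) auto
  have f: "is_hom (\<lambda>xs. Min (set xs)) (direct_power P1 ?k) P1"
    unfolding digraph_hom_iff[OF digraph_direct_power[OF digraph_P1] digraph_P1]
  proof (intro conjI allI impI)
    show "(\<lambda>xs. Min (set xs)) ` universe (direct_power P1 ?k) \<subseteq> universe P1"
    proof (rule image_subsetI)
      fix xs assume "xs \<in> universe (direct_power P1 ?k)"
      then have "set xs \<subseteq> {0, 1}" "set xs \<noteq> {}"
        using k unfolding direct_power_def tuples_def by auto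
      moreover from this have "Min (set xs) \<in> set xs" by (intro Min_in) auto
      ultimately show "Min (set xs) \<in> universe P1" unfolding universe_P1 by blast
    qed
    fix xs ys assume "edge (direct_power P1 ?k) xs ys"
    \<comment> \<open>The edge must be the pair (0, 1) in every coordinate, so every power of
      \<open>P1\<close> has just one edge.\<close>
    then have "xs = replicate ?k 0" "ys = replicate ?k 1"
      by (auto simp: edge_direct_power digraph_P1 tuples_def intro!: nth_equalityI)
    then have "set xs = {0}" "set ys = {1}" using k by (auto simp: set_replicate_conv_if)
    then show "edge P1 (Min (set xs)) (Min (set ys))" by simp
  qed
  have sG: "is_struc G" using dG unfolding digraph_def by blast
  obtain F where F: "is_hom F (direct_power G ?k) G"
    and mi: "\<And>r \<alpha> \<beta>. set \<alpha> \<union> set \<beta> \<subseteq> {..<r} \<Longrightarrow>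
      minor_identity (\<lambda>xs. Min (set xs)) (universe P1) r \<alpha> \<beta> \<Longrightarrow> minor_identity F (universe G) r \<alpha> \<beta>"
    using pp_le_polymorphism[OF sG le f k] by auto
  have "\<forall>v. \<exists>i. v \<in> universe G \<longrightarrow> i < ?k \<and> vs ! i = v"
    using vs by (metis in_set_conv_nth)
  from choice[OF this] obtain ix where ix: "\<And>v. v \<in> universe G \<Longrightarrow> ix v < ?k"
    "\<And>v. v \<in> universe G \<Longrightarrow> vs ! ix v = v" by blast
  \<comment> \<open>\<open>\<beta>\<close> lists the positions in \<open>vs\<close> of the
    successors of its entries. It meets every position, so the minors of \<open>Min\<close> given by
    \<open>[0..<?k]\<close> and \<open>\<beta>\<close> see the same set of values.\<close>
  define \<beta> where "\<beta> = map (\<lambda>i. ix (\<sigma> (vs ! i))) [0..<?k]"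
  have vU: "vs ! i \<in> universe G" if "i < ?k" for i
    using that vs nth_mem by blast
  have \<beta>: "set \<beta> = {..<?k}"
  proof
    show "set \<beta> \<subseteq> {..<?k}" unfolding \<beta>_def using ix(1) \<sigma>U vU by auto
    show "{..<?k} \<subseteq> set \<beta>"
    proof
      fix j assume "j \<in> {..<?k}"
      then have j: "j < ?k" by simp
      obtain u where "u \<in> universe G" "vs ! j = \<sigma> u" using surj vU[OF j] by blast
      then obtain i where i: "i < ?k" "vs ! j = \<sigma> (vs ! i)" using vs by (metis in_set_conv_nth)
      have "ix (\<sigma> (vs ! i)) = j"
        using ix[OF vU[OF j]] nth_eq_iff_index_eq[OF dist _ j] i(2) by simp
      then show "j \<in> set \<beta>" unfolding \<beta>_def using i(1) by force
    qed
  qed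
  have "minor_identity F (universe G) ?k [0..<?k] \<beta>"
  proof (rule mi)
    show "set [0..<?k] \<union> set \<beta> \<subseteq> {..<?k}" unfolding \<beta> by auto
    have "set [0..<?k] = set \<beta>" unfolding \<beta> by auto
    then show "minor_identity (\<lambda>xs. Min (set xs)) (universe P1) ?k [0..<?k] \<beta>"
      unfolding minor_identity_def set_map by simp
  qed
  moreover have "vs \<in> tuples (universe G) ?k" using vs unfolding tuples_def by simp
  ultimately have "F (map ((!) vs) [0..<?k]) = F (map ((!) vs) \<beta>)"
    unfolding minor_identity_def by blast
  moreover have "map ((!) vs) \<beta> = map \<sigma> vs"
    unfolding \<beta>_def using ix(2) \<sigma>U vU by (auto intro!: nth_equalityI)
  ultimately have eq: "F vs = F (map \<sigma> vs)" by (simp add: map_nth)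
  have "edge (direct_power G ?k) vs (map \<sigma> vs)"
    unfolding edge_direct_power[OF dG] using vs \<sigma> \<sigma>U vU by (auto simp: tuples_def)
  then have "edge G (F vs) (F (map \<sigma> vs))"
    using F dG by (simp add: digraph_hom_iff digraph_direct_power)
  then show ?thesis using eq by metis
qed

section \<open>Directed paths\<close>

definition path :: "nat \<Rightarrow> nat digraph" where
  "path l = make_digraph {..l} {(i, Suc i) | i. i < l}"

lemma digraph_path: "digraph (path l)"
  unfolding path_def by (rule digraph_make_digraph) auto

lemma edge_path [simp]: "edge (path l) i j \<longleftrightarrow> i < l \<and> j = Suc i"
  unfolding path_def by auto

lemma universe_path [simp]: "universe (path l) = {..l}"
  unfolding path_def by simp

text \<open>In the power of dimension \<open>l\<close>, an edge shifts a tuple by one place, inserting \<open>1\<close> at the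
  front and dropping a final \<open>0\<close>; this raises the number of ones by one.\<close>

lemma P1_le_path:
  assumes l: "l \<ge> 1"
  shows "pp_le P1 (path l)"
proof -
  obtain k where k: "l = Suc k" using l by (cases l) auto
  let ?E = "{(x @ [0], 1 # x) | x. x \<in> tuples {0, 1 :: nat} k}"
  have ar: "arity P1 () = 2" using digraph_P1 unfolding digraph_def by blast
  have edge: "pp_expr P1 (\<lambda>e. edge P1 (e i) (e j))" for i j
    using pp_expr_rel[of "[i, j]" P1 "()"] ar by (simp add: edge_def)
  \<comment> \<open>The constants are definable: 0 is the vertex with an outgoing edge, 1 the one
    with an incoming edge.\<close>
  have c0: "pp_expr P1 (\<lambda>e. e i = 0)" for i
    by (rule pp_expr_cong[OF pp_expr_ex[OF edge[of i "Suc i"], of "Suc i"]]) auto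
  have c1: "pp_expr P1 (\<lambda>e. e i = 1)" for i
    by (rule pp_expr_cong[OF pp_expr_ex[OF edge[of "Suc i" i], of "Suc i"]]) auto
  have "pp_expr P1 (\<lambda>e. e k = 0 \<and> e l = 1 \<and> (\<forall>i < k. e i = e (Suc l + i)))"
    by (intro pp_expr_conj pp_expr_all_less pp_expr_eq c0 c1)
  then have expr: "pp_expr P1 (\<lambda>e. (map e [0..<l], map e [l..<l + l]) \<in> ?E)"
  proof (rule pp_expr_cong)
    fix e :: "nat \<Rightarrow> nat" assume e: "range e \<subseteq> universe P1"
    have 1: "map e [0..<l] = map e [0..<k] @ [e k]" unfolding k by simp
    have 2: "map e [l..<l + l] = e l # map e [Suc l..<Suc l + k]"
      unfolding k by (subst upt_conv_Cons) auto
    have 3: "map e [0..<k] \<in> tuples {0, 1} k" using e by (intro map_in_tuples) auto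
    have 4: "map e [0..<k] = map e [Suc l..<Suc l + k] \<longleftrightarrow> (\<forall>i < k. e i = e (Suc l + i))"
      by (auto simp: list_eq_iff_nth_eq simp del: upt_Suc)
    show "(e k = 0 \<and> e l = 1 \<and> (\<forall>i < k. e i = e (Suc l + i))) =
        ((map e [0..<l], map e [l..<l + l]) \<in> ?E)"
      unfolding 1 2 4[symmetric] using 3 by auto
  qed
  have le: "sum_list x \<le> length x" if "set x \<subseteq> {0, 1}" for x :: "nat list"
    using that by (induction x) auto
  show ?thesis
  \<comment> \<open>\<open>sum_list\<close> counts the ones; in the other direction, vertex
    \<open>i\<close> becomes \<open>i\<close> ones followed by zeros.\<close>
  proof (rule pp_le_digraphI[OF _ digraph_path l _ expr, where f = sum_list and
        g = "\<lambda>i. replicate i 1 @ replicate (l - i) 0"])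
    show "?E \<subseteq> tuples (universe P1) l \<times> tuples (universe P1) l"
      unfolding k by (auto simp: tuples_def)
    show "sum_list x \<in> universe (path l)" if "x \<in> tuples (universe P1) l" for x
      using that le[of x] unfolding tuples_def by simp
    show "edge (path l) (sum_list x) (sum_list y)" if "(x, y) \<in> ?E" for x y
      using that le unfolding tuples_def by (fastforce simp: k)
    show "replicate i 1 @ replicate (l - i) 0 \<in> tuples (universe P1) l" if "i \<in> universe (path l)" for i
      using that unfolding tuples_def by auto
    show "(replicate i 1 @ replicate (l - i) 0, replicate j 1 @ replicate (l - j) 0) \<in> ?E"
      if "edge (path l) i j" for i j
    proof -
      have ij: "i < l" "j = Suc i" using that by auto
      then have "l - i = Suc (k - i)" "l - j = k - i" using k by auto
      then have "replicate i 1 @ replicate (l - i) 0 = (replicate i 1 @ replicate (k - i) 0) @ [0::nat]"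
        "replicate j 1 @ replicate (l - j) 0 = 1 # (replicate i 1 @ replicate (k - i) (0::nat))"
        using ij by (auto simp: replicate_append_same)
      moreover have "replicate i 1 @ replicate (k - i) 0 \<in> tuples {0, 1 :: nat} k"
        using ij k unfolding tuples_def by auto
      ultimately show ?thesis by blast
    qed
  qed auto
qed

section \<open>Totally rectangular digraphs\<close>

text \<open>Equivalently, for every \<open>k\<close> the sets of vertices reached from two vertices
  by walks of length \<open>k\<close> are equal or disjoint.\<close>

definition totally_rectangular :: "('a \<times> 'a) set \<Rightarrow> bool" where
  "totally_rectangular E \<longleftrightarrow>
     (\<forall>k a b c d. (a, c) \<in> E ^^ k \<longrightarrow> (b, c) \<in> E ^^ k \<longrightarrow> (b, d) \<in> E ^^ k \<longrightarrow> (a, d) \<in> E ^^ k)"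

lemma totally_rectangularD:
  "totally_rectangular E \<Longrightarrow> (a, c) \<in> E ^^ k \<Longrightarrow> (b, c) \<in> E ^^ k \<Longrightarrow> (b, d) \<in> E ^^ k \<Longrightarrow> (a, d) \<in> E ^^ k"
  unfolding totally_rectangular_def by blast

text \<open>Vertex sets with sets of pairs make \<open>E ^^ k\<close>, images and
  \<open>Domain\<close> available; \<open>hom_equivalent_make_digraph\<close> returns to
  structures.\<close>

definition rel_hom :: "('a \<Rightarrow> 'b) \<Rightarrow> 'a set \<Rightarrow> ('a \<times> 'a) set \<Rightarrow> 'b set \<Rightarrow> ('b \<times> 'b) set \<Rightarrow> bool" where
  "rel_hom f V E W F \<longleftrightarrow> f ` V \<subseteq> W \<and> (\<forall>x y. (x, y) \<in> E \<longrightarrow> (f x, f y) \<in> F)"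

definition rel_hom_equivalent :: "'a set \<Rightarrow> ('a \<times> 'a) set \<Rightarrow> 'b set \<Rightarrow> ('b \<times> 'b) set \<Rightarrow> bool" where
  "rel_hom_equivalent V E W F \<longleftrightarrow> (\<exists>f. rel_hom f V E W F) \<and> (\<exists>g. rel_hom g W F V E)"

lemma rel_hom_equivalent_refl: "rel_hom_equivalent V E V E"
  unfolding rel_hom_equivalent_def rel_hom_def by (metis image_ident subset_refl)

lemma rel_hom_comp: "rel_hom f V E W F \<Longrightarrow> rel_hom g W F X H \<Longrightarrow> rel_hom (g \<circ> f) V E X H"
  unfolding rel_hom_def by (auto simp: image_subset_iff)

lemma rel_hom_equivalent_trans:
  "rel_hom_equivalent V E W F \<Longrightarrow> rel_hom_equivalent W F X H \<Longrightarrow> rel_hom_equivalent V E X H"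
  unfolding rel_hom_equivalent_def using rel_hom_comp by metis

definition permutation_graph :: "'a set \<Rightarrow> ('a \<times> 'a) set \<Rightarrow> bool" where
  "permutation_graph U F \<longleftrightarrow> finite U \<and> U \<noteq> {} \<and> F \<subseteq> U \<times> U \<and>
     (\<forall>v \<in> U. (\<exists>!u. (u, v) \<in> F) \<and> (\<exists>!w. (v, w) \<in> F))"

abbreviation path_edges :: "nat \<Rightarrow> (nat \<times> nat) set" where
  "path_edges l \<equiv> {(i, Suc i) | i. i < l}"

text \<open>By induction on the number of vertices: identify the vertices of \<open>E\<close> that have the same
  nonempty set of successors (\<open>b\<close> chooses a representative of each class) and drop the sinks. The
  quotient \<open>B\<close> is again totally rectangular and, unless \<open>E\<close> is already a permutation, smaller.
  Passing from \<open>B\<close> back to \<open>E\<close> lengthens a path by one edge and leaves a permutation unchanged.\<close>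

lemma totally_rectangular_cases:
  assumes "finite V" "V \<noteq> {}" "E \<subseteq> V \<times> V" "totally_rectangular E"
  shows "(\<exists>l. rel_hom_equivalent V E {..l} (path_edges l)) \<or>
         (\<exists>U F. permutation_graph (U :: 'a set) F \<and> rel_hom_equivalent (V :: 'a set) E U F)"
  using assms
proof (induction "card V" arbitrary: V E rule: less_induct)
  case less
  note V = less.prems(1,2) and EV = less.prems(3) and rect = less.prems(4)
  have rect1: "(a, d) \<in> E" if "(a, c) \<in> E" "(b, c) \<in> E" "(b, d) \<in> E" for a b c d
    using totally_rectangularD[OF rect, of a c 1 b d] that by simp
  show ?case
  proof (cases "E = {}")
    case True
    obtain v where "v \<in> V" using V by blast
    have "rel_hom (\<lambda>_. 0) V E {..0} (path_edges 0)" "rel_hom (\<lambda>_. v) {..0} (path_edges 0) V E"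
      using True \<open>v \<in> V\<close> by (auto simp: rel_hom_def)
    then show ?thesis unfolding rel_hom_equivalent_def by blast
  next
    case False
    \<comment> \<open>The choice depends on the successor set of \<open>x\<close> only, so
      \<open>b\<close> is constant on each class, and a representative has the same outgoing edges
      as the vertex it replaces.\<close>
    define b where "b x = (SOME x'. E `` {x'} = E `` {x})" for x
    have b: "E `` {b x} = E `` {x}" for x
      unfolding b_def by (rule someI[of _ x]) simp
    have b_edge: "(b x, y) \<in> E \<longleftrightarrow> (x, y) \<in> E" for x y using b by blast
    have b_eq: "b x = b y" if "E `` {x} = E `` {y}" for x y using that unfolding b_def by simp
    have b_eqI: "b x = b y" if "(x, z) \<in> E" "(y, z) \<in> E" for x y z
      by (rule b_eq) (use rect1 that in blast)
    have b_idem: "b (b x) = b x" for x by (rule b_eq) (rule b)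
    define S where "S = Domain E"
    have S: "x \<in> S \<longleftrightarrow> (\<exists>y. (x, y) \<in> E)" for x unfolding S_def by blast
    have SV: "S \<subseteq> V" using EV S by blast
    have bS: "b x \<in> S \<longleftrightarrow> x \<in> S" for x using S b_edge by blast
    define R where "R = b ` S"
    have bR: "b x = x" if "x \<in> R" for x using that b_idem unfolding R_def by auto
    have RS: "R \<subseteq> S" using bS unfolding R_def by blast
    define B where "B = {(r, b y) | r y. r \<in> R \<and> y \<in> S \<and> (r, y) \<in> E}"
    have BR: "B \<subseteq> R \<times> R" unfolding B_def R_def by blast
    have B_edge: "(b x, b y) \<in> B" if "(x, y) \<in> E" "y \<in> S" for x y
      using that S b_edge unfolding B_def R_def by blast
    define p where "p y = (SOME x. (x, y) \<in> E)" for y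
    have p: "(p y, y) \<in> E" if "y \<in> Range E" for y
      using that unfolding p_def by (metis Range_iff someI)
    \<comment> \<open>All predecessors of \<open>y\<close> share the successor \<open>y\<close>,
      hence lie in one class; the choice made by \<open>p\<close> is immaterial after applying
      \<open>b\<close>.\<close>
    have b_p: "b (p y) = b x" if "(x, y) \<in> E" for x y
      by (rule b_eqI[OF p that]) (use that in blast)
    \<comment> \<open>Replacing an intermediate vertex by its representative keeps its outgoing
      edges, so a nonempty walk in \<open>B\<close> is a walk in \<open>E\<close> whose last vertex
      alone is replaced.\<close>
    have Bk: "(r, s) \<in> B ^^ Suc k \<longleftrightarrow> (\<exists>y \<in> S. r \<in> R \<and> s = b y \<and> (r, y) \<in> E ^^ Suc k)" for r s k
    proof (induction k arbitrary: s)
      case 0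
      then show ?case unfolding B_def by auto
    next
      case (Suc k)
      have "(r, s) \<in> B ^^ Suc (Suc k) \<longleftrightarrow> (\<exists>t. (r, t) \<in> B ^^ Suc k \<and> (t, s) \<in> B)" by auto
      also have "\<dots> \<longleftrightarrow> (\<exists>y \<in> S. r \<in> R \<and> (r, y) \<in> E ^^ Suc k \<and> (b y, s) \<in> B)"
        unfolding Suc by blast
      also have "\<dots> \<longleftrightarrow> (\<exists>y \<in> S. r \<in> R \<and> (r, y) \<in> E ^^ Suc k \<and> (\<exists>z \<in> S. s = b z \<and> (y, z) \<in> E))"
        unfolding B_def using b_edge R_def by blast
      also have "\<dots> \<longleftrightarrow> (\<exists>z \<in> S. r \<in> R \<and> s = b z \<and> (\<exists>y. (r, y) \<in> E ^^ Suc k \<and> (y, z) \<in> E))"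
        using S by blast
      also have "\<dots> \<longleftrightarrow> (\<exists>z \<in> S. r \<in> R \<and> s = b z \<and> (r, z) \<in> E ^^ Suc (Suc k))" by auto
      finally show ?case .
    qed
    have "totally_rectangular B"
      unfolding totally_rectangular_def
    proof (intro allI impI)
      fix k p q s t assume h: "(p, s) \<in> B ^^ k" "(q, s) \<in> B ^^ k" "(q, t) \<in> B ^^ k"
      show "(p, t) \<in> B ^^ k"
      proof (cases k)
        case 0
        then show ?thesis using h by auto
      next
        case (Suc j)
        obtain y where y: "y \<in> S" "p \<in> R" "s = b y" "(p, y) \<in> E ^^ k" using h(1) Bk Suc by blast
        obtain y' where y': "y' \<in> S" "q \<in> R" "s = b y'" "(q, y') \<in> E ^^ k" using h(2) Bk Suc by blast
        obtain z where z: "z \<in> S" "t = b z" "(q, z) \<in> E ^^ k" using h(3) Bk Suc by blast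
        \<comment> \<open>\<open>y\<close> and \<open>y'\<close> share a representative, hence the
          successor \<open>w\<close>. Rectangularity at \<open>Suc k\<close> takes \<open>p\<close>
          to the successor \<open>v\<close> of \<open>z\<close>; the vertex before \<open>v\<close>
          on that walk shares \<open>v\<close> with \<open>z\<close>, so its representative is
          \<open>t\<close>.\<close>
        obtain w where w: "(y, w) \<in> E" using y S by blast
        then have w': "(y', w) \<in> E" using y(3) y'(3) b_edge by metis
        obtain v where v: "(z, v) \<in> E" using z S by blast
        have "(p, v) \<in> E ^^ Suc k"
          by (rule totally_rectangularD[OF rect, of p w "Suc k" q v]) (use y y' z w w' v in auto)
        then obtain z' where z': "(p, z') \<in> E ^^ k" "(z', v) \<in> E" by auto
        then have "t = b z'" "z' \<in> S" using z(2) b_eqI v S by blast+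
        then show ?thesis using Bk y(2) z'(1) Suc by blast
      qed
    qed
    have finS: "finite S" using finite_subset[OF SV V(1)] .
    then have "finite R" "R \<noteq> {}" using False unfolding R_def S_def by auto
    have card: "card R \<le> card S" "card S \<le> card V"
      unfolding R_def by (rule card_image_le[OF finS], rule card_mono[OF V(1) SV])
    show ?thesis
    proof (cases "card R = card V")
      case True
      \<comment> \<open>Nothing was lost: there are no sinks and \<open>b\<close> is injective, so
        no two vertices share a successor. A choice of successors is then injective, hence onto,
        which leaves no room for further edges.\<close>
      have SV: "S = V" using card True SV V(1) by (intro card_subset_eq) auto
      have inj: "inj_on b V"
        using True V(1) unfolding R_def SV by (intro eq_card_imp_inj_on)
      have in_unique: "x = y" if "(x, z) \<in> E" "(y, z) \<in> E" for x y z
        using inj b_eqI[OF that] that EV by (auto dest: inj_onD)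
      define \<sigma> where "\<sigma> x = (SOME y. (x, y) \<in> E)" for x
      have \<sigma>: "(x, \<sigma> x) \<in> E" if "x \<in> V" for x
        using that S unfolding SV \<sigma>_def by (metis someI)
      have "inj_on \<sigma> V" using \<sigma> in_unique by (metis inj_onI)
      then have surj: "\<sigma> ` V = V" using \<sigma> EV V(1) by (intro endo_inj_surj) auto
      have \<sigma>_unique: "y = \<sigma> x" if "(x, y) \<in> E" for x y
      proof -
        obtain x' where "x' \<in> V" "y = \<sigma> x'" using surj EV \<open>(x, y) \<in> E\<close> by blast
        then show ?thesis using \<sigma> in_unique that by metis
      qed
      have "permutation_graph V E"
        unfolding permutation_graph_def
      proof (intro conjI ballI V EV)
        fix v assume v: "v \<in> V"
        then obtain u where "u \<in> V" "v = \<sigma> u" using surj by blast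
        then show "\<exists>!u. (u, v) \<in> E" using \<sigma> in_unique by metis
        show "\<exists>!w. (v, w) \<in> E" using \<sigma>[OF v] \<sigma>_unique by metis
      qed
      then show ?thesis using rel_hom_equivalent_refl by blast
    next
      case smaller: False
      have "card R < card V" using smaller card by simp
      from less.hyps[OF this \<open>finite R\<close> \<open>R \<noteq> {}\<close> BR \<open>totally_rectangular B\<close>]
      show ?thesis
      proof (elim disjE exE conjE)
        fix l assume "rel_hom_equivalent R B {..l} (path_edges l)"
        then obtain f g where f: "rel_hom f R B {..l} (path_edges l)"
          and g: "rel_hom g {..l} (path_edges l) R B" unfolding rel_hom_equivalent_def by blast
        have f_edge: "Suc (f (b x)) = f (b y) \<and> f (b x) < l" if "(x, y) \<in> E" "y \<in> S" for x y
          using f B_edge[OF that] unfolding rel_hom_def by auto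
        \<comment> \<open>A sink goes one step beyond its predecessors, possibly to the new endpoint
          \<open>Suc l\<close>; isolated vertices go to 0.\<close>
        define f' where "f' x = (if x \<in> S then f (b x)
          else if x \<in> Range E then Suc (f (b (p x))) else 0)" for x
        have "rel_hom f' V E {..Suc l} (path_edges (Suc l))"
          unfolding rel_hom_def
        proof (intro conjI allI impI image_subsetI)
          have fl: "f (b x) \<le> l" if "x \<in> S" for x
            using that f unfolding rel_hom_def R_def by auto
          show "f' x \<in> {..Suc l}" for x
            using fl[of x] fl[of "p x"] p S unfolding f'_def by force
          fix x y assume xy: "(x, y) \<in> E"
          then have x: "x \<in> S" and y: "y \<in> Range E" using S by blast+
          show "(f' x, f' y) \<in> path_edges (Suc l)"
            using f_edge[OF xy] fl[OF x] b_p[OF xy] x y unfolding f'_def by auto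
        qed
        moreover
        \<comment> \<open>Each edge of \<open>B\<close> is lifted to an edge of \<open>E\<close>
          into the class of its head. The representative \<open>g l\<close> is no sink, so one edge
          can be added at the end; the lifted path is \<open>g 0\<close>, \<open>h 0\<close>, ...,
          \<open>h l\<close>.\<close>
        have "\<forall>i. \<exists>y. i \<le> l \<longrightarrow> (g i, y) \<in> E \<and> (i < l \<longrightarrow> b y = g (Suc i))"
        proof
          fix i
          show "\<exists>y. i \<le> l \<longrightarrow> (g i, y) \<in> E \<and> (i < l \<longrightarrow> b y = g (Suc i))"
          proof (cases "i < l")
            case True
            then have "(g i, g (Suc i)) \<in> B" using g unfolding rel_hom_def by blast
            then show ?thesis unfolding B_def by auto
          next
            case False
            have "g i \<in> S" if "i \<le> l" using that g RS unfolding rel_hom_def by auto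
            then show ?thesis using False S by blast
          qed
        qed
        from choice[OF this] obtain h where
          h: "\<And>i. i \<le> l \<Longrightarrow> (g i, h i) \<in> E" "\<And>i. i < l \<Longrightarrow> b (h i) = g (Suc i)" by force
        have "rel_hom (case_nat (g 0) h) {..Suc l} (path_edges (Suc l)) V E"
          unfolding rel_hom_def
        proof (intro conjI allI impI image_subsetI)
          fix i assume "i \<in> {..Suc l}"
          then show "case_nat (g 0) h i \<in> V" using h(1) EV by (cases i) auto
        next
          fix i j assume "(i, j) \<in> path_edges (Suc l)"
          then have ij: "j = Suc i" "i \<le> l" by auto
          show "(case_nat (g 0) h i, case_nat (g 0) h j) \<in> E"
          proof (cases i)
            case 0
            then show ?thesis using ij h(1)[of 0] by simp
          next
            case (Suc m)
            then have "(b (h m), h i) \<in> E" using ij h(1)[of i] h(2)[of m] by simp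
            then show ?thesis using Suc ij b_edge by simp
          qed
        qed
        ultimately show ?thesis unfolding rel_hom_equivalent_def by blast
      next
        fix U :: "'a set" and F assume U: "permutation_graph U F" "rel_hom_equivalent R B U F"
        then obtain f g where f: "rel_hom f R B U F"
          and g: "rel_hom g U F R B" unfolding rel_hom_equivalent_def by blast
        obtain u where u: "u \<in> U" using U(1) unfolding permutation_graph_def by blast
        define \<sigma> where "\<sigma> v = (THE w. (v, w) \<in> F)" for v
        have \<sigma>: "(v, \<sigma> v) \<in> F" if "v \<in> U" for v
          using U(1) that theI'[of "\<lambda>w. (v, w) \<in> F"] unfolding permutation_graph_def \<sigma>_def by blast
        have FU: "F \<subseteq> U \<times> U" using U(1) unfolding permutation_graph_def by blast
        have f_edge: "(f (b x), f (b y)) \<in> F" if "(x, y) \<in> E" "y \<in> S" for x y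
          using f B_edge[OF that] unfolding rel_hom_def by auto
        \<comment> \<open>A sink follows its predecessors along the permutation; isolated vertices
          go to an arbitrary \<open>u\<close>.\<close>
        define f' where "f' x = (if x \<in> S then f (b x)
          else if x \<in> Range E then \<sigma> (f (b (p x))) else u)" for x
        have "rel_hom f' V E U F"
          unfolding rel_hom_def
        proof (intro conjI allI impI image_subsetI)
          have fU: "f (b x) \<in> U" if "x \<in> S" for x
            using that f unfolding rel_hom_def R_def by auto
          have "p x \<in> S" if "x \<in> Range E" for x using p[OF that] S by blast
          then show "f' x \<in> U" for x
            using fU[of x] \<sigma>[OF fU[of "p x"]] FU u unfolding f'_def by auto
          fix x y assume xy: "(x, y) \<in> E"
          then have x: "x \<in> S" and y: "y \<in> Range E" using S by blast+
          show "(f' x, f' y) \<in> F"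
            using f_edge[OF xy] \<sigma>[OF fU[OF x]] b_p[OF xy] x y unfolding f'_def by auto
        qed
        moreover
        \<comment> \<open>The predecessor of \<open>v\<close> in \<open>F\<close> is unique, so only
          one edge has to be lifted: \<open>h v\<close> is a member of the class of
          \<open>g v\<close> that this edge reaches in \<open>E\<close>.\<close>
        have "\<forall>v. \<exists>y. v \<in> U \<longrightarrow> y \<in> S \<and> b y = g v \<and> (\<forall>w. (w, v) \<in> F \<longrightarrow> (g w, y) \<in> E)"
        proof
          fix v
          show "\<exists>y. v \<in> U \<longrightarrow> y \<in> S \<and> b y = g v \<and> (\<forall>w. (w, v) \<in> F \<longrightarrow> (g w, y) \<in> E)"
          proof (cases "v \<in> U")
            case True
            then have ex: "\<exists>!w. (w, v) \<in> F" using U(1) unfolding permutation_graph_def by blast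
            then obtain w where w: "(w, v) \<in> F" by blast
            then have "(g w, g v) \<in> B" using g unfolding rel_hom_def by blast
            then obtain y where y: "y \<in> S" "g v = b y" "(g w, y) \<in> E" unfolding B_def by blast
            moreover have "w' = w" if "(w', v) \<in> F" for w' using ex w that by blast
            ultimately show ?thesis by metis
          qed blast
        qed
        from choice[OF this] obtain h where h: "\<And>v. v \<in> U \<Longrightarrow> h v \<in> S"
          "\<And>v. v \<in> U \<Longrightarrow> b (h v) = g v" "\<And>v w. v \<in> U \<Longrightarrow> (w, v) \<in> F \<Longrightarrow> (g w, h v) \<in> E" by blast
        have "rel_hom h U F V E"
          unfolding rel_hom_def
        proof (intro conjI allI impI image_subsetI)
          show "h v \<in> V" if "v \<in> U" for v using h(1)[OF that] SV by blast
          fix w v assume wv: "(w, v) \<in> F"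
          then have "(b (h w), h v) \<in> E" using h FU by auto
          then show "(h w, h v) \<in> E" using b_edge by blast
        qed
        ultimately show ?thesis using U(1) unfolding rel_hom_equivalent_def by blast
      qed
    qed
  qed
qed

section \<open>Quasi Maltsev digraphs\<close>

text \<open>By the pigeonhole principle two powers of \<open>u\<close> agree on \<open>V\<close>, so
  from exponent \<open>i\<close> on the powers have a period \<open>q\<close>. A positive multiple
  of \<open>q\<close> that is at least \<open>i\<close> is idempotent.\<close>

lemma idempotent_funpow:
  assumes V: "finite V" and u: "u ` V \<subseteq> V"
  shows "\<exists>N \<ge> 1. \<forall>x \<in> V. (u ^^ N) ((u ^^ N) x) = (u ^^ N) x"
proof -
  have uV: "(u ^^ n) x \<in> V" if "x \<in> V" for n x
    using that u by (induction n) auto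
  \<comment> \<open>The behaviour of \<open>u\<close> outside \<open>V\<close> is unknown; a fixed
    value there leaves only finitely many functions.\<close>
  let ?g = "\<lambda>n x. if x \<in> V then (u ^^ n) x else undefined"
  have "range ?g \<subseteq> {f. \<forall>x. (x \<in> V \<longrightarrow> f x \<in> V) \<and> (x \<notin> V \<longrightarrow> f x = undefined)}"
    using uV by auto
  then have "finite (range ?g)"
    using finite_set_of_finite_funs[OF V V] finite_subset by blast
  then have "\<not> inj ?g" using finite_imageD infinite_UNIV_nat by blast
  then obtain i j where ij: "?g i = ?g j" "i < j"
    unfolding inj_def by (metis linorder_neqE_nat)
  define q where "q = j - i"
  have q: "j = i + q" "q \<ge> 1" using ij(2) unfolding q_def by auto
  have step: "(u ^^ (n + q)) x = (u ^^ n) x" if "x \<in> V" "i \<le> n" for n x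
  proof -
    have "(u ^^ j) x = (u ^^ i) x" using fun_cong[OF ij(1), of x] that(1) by simp
    then have "(u ^^ (n - i)) ((u ^^ j) x) = (u ^^ (n - i)) ((u ^^ i) x)" by (rule arg_cong)
    then have "(u ^^ (n - i + j)) x = (u ^^ (n - i + i)) x" by (simp only: funpow_add comp_apply)
    then show ?thesis using that(2) q(1) by (simp add: add.commute)
  qed
  have steps: "(u ^^ (n + k * q)) x = (u ^^ n) x" if "x \<in> V" "i \<le> n" for n k x
  proof (induction k)
    case (Suc k)
    have "(u ^^ (n + Suc k * q)) x = (u ^^ (n + k * q + q)) x" by (simp add: algebra_simps)
    then show ?case using step[OF that(1), of "n + k * q"] that(2) Suc by simp
  qed simp
  let ?N = "Suc i * q"
  have "i \<le> i * q" using q(2) by (cases q) auto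
  then have N: "i \<le> ?N" "?N \<ge> 1" unfolding mult_Suc using q(2) by linarith+
  have "(u ^^ ?N) ((u ^^ ?N) x) = (u ^^ ?N) x" if "x \<in> V" for x
    using steps[OF that N(1), of "Suc i"] by (simp only: funpow_add comp_apply)
  then show ?thesis using N(2) by blast
qed

text \<open>Let \<open>r\<close> be an idempotent power of the endomorphism \<open>u x = f(x, x, x)\<close>. Composing \<open>f\<close> with a
  suitable power of \<open>u\<close> gives an idempotent Maltsev operation on the image of \<open>r\<close>.\<close>

lemma quasi_maltsev_retract:
  assumes G: "digraph G" "finite (universe G)" and maltsev: "has_quasi_maltsev G"
  shows "\<exists>V E. V \<subseteq> universe G \<and> V \<noteq> {} \<and> E \<subseteq> V \<times> V \<and> totally_rectangular E \<and>
    rel_hom_equivalent (universe G) {(x, y). edge G x y} V E"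
proof -
  let ?U = "universe G"
  obtain f where f: "is_hom f (direct_power G 3) G"
    and qm: "\<And>x y. x \<in> ?U \<Longrightarrow> y \<in> ?U \<Longrightarrow> f [y, y, x] = f [x, x, x] \<and> f [x, x, x] = f [x, y, y]"
    using maltsev unfolding has_quasi_maltsev_def by blast
  have tup: "[a, b, c] \<in> tuples ?U 3" if "a \<in> ?U" "b \<in> ?U" "c \<in> ?U" for a b c
    using that unfolding tuples_def by simp
  have fU: "f [a, b, c] \<in> ?U" if "a \<in> ?U" "b \<in> ?U" "c \<in> ?U" for a b c
    using f tup[OF that] unfolding is_hom_def direct_power_def by auto
  have f_edge: "edge G (f [a, b, c]) (f [a', b', c'])"
    if "edge G a a'" "edge G b b'" "edge G c c'" for a b c a' b' c'
  proof -
    have "edge (direct_power G 3) [a, b, c] [a', b', c']"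
      unfolding edge_direct_power[OF G(1)]
      using that digraph_edge_universe[OF G(1)] tup by (auto simp: less_Suc_eq numeral_3_eq_3)
    then show ?thesis using f by (simp add: digraph_hom_iff digraph_direct_power G(1))
  qed
  define u where "u x = f [x, x, x]" for x
  have uU: "(u ^^ n) x \<in> ?U" if "x \<in> ?U" for n x
    using that by (induction n) (auto simp: u_def fU)
  have u_edge: "edge G ((u ^^ n) x) ((u ^^ n) y)" if "edge G x y" for n x y
    using that by (induction n) (auto simp: u_def f_edge)
  have "u ` ?U \<subseteq> ?U" using uU[of _ 1] by auto
  then obtain N where N: "N \<ge> 1" "\<forall>x \<in> ?U. (u ^^ N) ((u ^^ N) x) = (u ^^ N) x"
    using idempotent_funpow[OF G(2)] by blast
  obtain n where n: "N = Suc n" using N(1) by (cases N) auto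
  define r where "r = u ^^ N"
  define V where "V = r ` ?U"
  define E where "E = {(x, y). edge G x y \<and> x \<in> V \<and> y \<in> V}"
  have rV: "r x = x" if "x \<in> V" for x using that N(2) unfolding V_def r_def by auto
  have VU: "V \<subseteq> ?U" using uU unfolding V_def r_def by auto
  define m where "m a b c = r ((u ^^ n) (f [a, b, c]))" for a b c
  have mV: "m a b c \<in> V" if "a \<in> V" "b \<in> V" "c \<in> V" for a b c
    unfolding m_def V_def using uU fU that VU by blast
  \<comment> \<open>Since \<open>N = Suc n\<close>, the factor \<open>u\<close> produced by the
    quasi Maltsev identities is completed to \<open>u ^^ N\<close>, which is the identity on
    \<open>V\<close>.\<close>
  have ru: "r ((u ^^ n) (u a)) = a" if "a \<in> V" for a
  proof -
    have "(u ^^ n) (u a) = r a" unfolding r_def n by (simp add: funpow_swap1)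
    then show ?thesis using rV that by simp
  qed
  have m1: "m a b b = a" if "a \<in> V" "b \<in> V" for a b
  proof -
    have "f [a, b, b] = u a" using qm that VU unfolding u_def by (metis subsetD)
    then show ?thesis using ru[OF that(1)] unfolding m_def by simp
  qed
  have m2: "m b b a = a" if "a \<in> V" "b \<in> V" for a b
  proof -
    have "f [b, b, a] = u a" using qm that VU unfolding u_def by (metis subsetD)
    then show ?thesis using ru[OF that(1)] unfolding m_def by simp
  qed
  have mE: "(m a b c, m a' b' c') \<in> E" if "(a, a') \<in> E" "(b, b') \<in> E" "(c, c') \<in> E" for a b c a' b' c'
    using that mV unfolding E_def by (auto simp: m_def r_def intro!: u_edge f_edge)
  have mEk: "(m a b c, m a' b' c') \<in> E ^^ k"
    if "(a, a') \<in> E ^^ k" "(b, b') \<in> E ^^ k" "(c, c') \<in> E ^^ k" for a b c a' b' c' k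
    using that
  proof (induction k arbitrary: a' b' c')
    case (Suc k)
    then obtain a1 b1 c1 where 1: "(a, a1) \<in> E ^^ k" "(a1, a') \<in> E" "(b, b1) \<in> E ^^ k" "(b1, b') \<in> E"
      "(c, c1) \<in> E ^^ k" "(c1, c') \<in> E" by auto
    have "(m a b c, m a1 b1 c1) \<in> E ^^ k" by (rule Suc.IH) (use 1 in blast)+
    moreover have "(m a1 b1 c1, m a' b' c') \<in> E" by (rule mE) (use 1 in blast)+
    ultimately show ?case by auto
  qed simp
  have EV: "E \<subseteq> V \<times> V" unfolding E_def by blast
  have EkV: "x \<in> V \<and> y \<in> V" if "(x, y) \<in> E ^^ Suc k" for x y k
  proof
    show "y \<in> V" using that EV by auto
    show "x \<in> V" using relpow_Suc_D2[OF that] EV by blast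
  qed
  have "totally_rectangular E"
    unfolding totally_rectangular_def
  proof (intro allI impI)
    fix k a b c d assume h: "(a, c) \<in> E ^^ k" "(b, c) \<in> E ^^ k" "(b, d) \<in> E ^^ k"
    show "(a, d) \<in> E ^^ k"
    proof (cases k)
      case 0
      then show ?thesis using h by auto
    next
      case (Suc j)
      \<comment> \<open>The three given walks, taken as the arguments of \<open>m\<close>, start at
        \<open>a\<close>, \<open>b\<close>, \<open>b\<close> and end at \<open>c\<close>,
        \<open>c\<close>, \<open>d\<close>; the Maltsev identities reduce the ends to
        \<open>a\<close> and \<open>d\<close>.\<close>
      have "(m a b b, m c c d) \<in> E ^^ k" using mEk h by blast
      then show ?thesis using m1[of a b] m2[of d c] EkV h unfolding Suc by metis
    qed
  qed
  moreover have "rel_hom r ?U {(x, y). edge G x y} V E"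
    using digraph_edge_universe[OF G(1)] u_edge[of _ _ N]
    unfolding rel_hom_def E_def V_def by (auto simp: r_def)
  moreover have "rel_hom (\<lambda>x. x) V E ?U {(x, y). edge G x y}"
    using VU unfolding rel_hom_def E_def by auto
  moreover have "V \<noteq> {}" using digraph_universe_nonempty[OF G(1)] unfolding V_def by blast
  ultimately show ?thesis using VU EV unfolding rel_hom_equivalent_def by blast
qed

lemma hom_equivalent_make_digraph:
  assumes G: "digraph G" and W: "W \<noteq> {}" "F \<subseteq> W \<times> W"
    and GW: "rel_hom_equivalent (universe G) {(x, y). edge G x y} W F"
  shows "hom_equivalent G (make_digraph W F)"
  using GW digraph_make_digraph[OF W] G
  unfolding hom_equivalent_def rel_hom_equivalent_def rel_hom_def
  by (simp add: digraph_hom_iff)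

lemma union_of_cycles_make_digraph:
  "permutation_graph U F \<Longrightarrow> union_of_cycles (make_digraph U F)"
  unfolding permutation_graph_def union_of_cycles_def finite_digraph_iff
  using digraph_make_digraph[of U F] by (simp add: Ex1_def)

lemma quasi_maltsev_cases:
  fixes G :: "'a digraph"
  assumes G: "digraph G" "finite (universe G)" and maltsev: "has_quasi_maltsev G"
  shows "(\<exists>l. hom_equivalent G (path l)) \<or>
    (\<exists>C :: 'a digraph. union_of_cycles C \<and> hom_equivalent G C)"
proof -
  obtain V E where VE: "V \<subseteq> universe G" "V \<noteq> {}" "E \<subseteq> V \<times> V" "totally_rectangular E"
    "rel_hom_equivalent (universe G) {(x, y). edge G x y} V E"
    using quasi_maltsev_retract[OF G maltsev] by blast
  have "finite V" using VE(1) G(2) finite_subset by blast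
  from totally_rectangular_cases[OF this VE(2,3,4)] show ?thesis
  proof (elim disjE exE conjE)
    fix l assume "rel_hom_equivalent V E {..l} (path_edges l)"
    from rel_hom_equivalent_trans[OF VE(5) this] have "hom_equivalent G (path l)"
      unfolding path_def by (intro hom_equivalent_make_digraph[OF G(1)]) auto
    then show ?thesis by blast
  next
    fix U :: "'a set" and F assume U: "permutation_graph U F" "rel_hom_equivalent V E U F"
    from rel_hom_equivalent_trans[OF VE(5) U(2)] have "hom_equivalent G (make_digraph U F)"
      using U(1) unfolding permutation_graph_def by (intro hom_equivalent_make_digraph[OF G(1)]) auto
    then show ?thesis using union_of_cycles_make_digraph[OF U(1)] by blast
  qed
qed

text \<open>Along edges of a partial bijection, equality of the first two arguments holds at the
  tails iff it holds at the heads, so both ends take the same branch of the case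
  distinction.\<close>

lemma partial_bijection_quasi_maltsev:
  assumes G: "digraph G" and "\<And>x y z. edge G x y \<Longrightarrow> edge G x z \<Longrightarrow> y = z"
    and "\<And>x y z. edge G x z \<Longrightarrow> edge G y z \<Longrightarrow> x = y"
  shows "has_quasi_maltsev G"
proof -
  let ?f = "\<lambda>t. if t ! 0 = t ! 1 then t ! 2 else t ! 0"
  have "edge G (?f s) (?f t)" if "edge (direct_power G 3) s t" for s t
  proof -
    have e: "edge G (s ! 0) (t ! 0)" "edge G (s ! 1) (t ! 1)" "edge G (s ! 2) (t ! 2)"
      using that unfolding edge_direct_power[OF G] by auto
    then have "s ! 0 = s ! 1 \<longleftrightarrow> t ! 0 = t ! 1" using assms(2,3) by metis
    then show ?thesis using e by simp
  qed
  moreover have "?f t \<in> universe G" if "t \<in> universe (direct_power G 3)" for t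
    using that nth_mem[of 0 t] nth_mem[of 2 t] unfolding direct_power_def tuples_def by auto
  ultimately have "is_hom ?f (direct_power G 3) G"
    unfolding digraph_hom_iff[OF digraph_direct_power[OF G] G] by blast
  then show ?thesis unfolding has_quasi_maltsev_def by (intro exI[of _ ?f]) simp
qed

lemma union_of_cycles_digraph: "union_of_cycles C \<Longrightarrow> digraph C"
  unfolding union_of_cycles_def finite_digraph_iff by blast

lemma union_of_cycles_quasi_maltsev:
  assumes "union_of_cycles C"
  shows "has_quasi_maltsev C"
proof (rule partial_bijection_quasi_maltsev)
  show C: "digraph C" using assms by (rule union_of_cycles_digraph)
  show "y = z" if "edge C x y" "edge C x z" for x y z
    using assms digraph_edge_universe[OF C that(1)] that unfolding union_of_cycles_def by blast
  show "x = y" if "edge C x z" "edge C y z" for x y z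
    using assms digraph_edge_universe[OF C that(1)] that unfolding union_of_cycles_def by blast
qed

section \<open>The posets\<close>

lemma mem_pp_class: "is_struc A \<Longrightarrow> A \<in> pp_class A"
  unfolding pp_class_def using pp_le_refl by blast

lemma pp_class_eq_iff:
  assumes "is_struc A" "is_struc B"
  shows "pp_class A = pp_class B \<longleftrightarrow> pp_le A B \<and> pp_le B A"
proof
  assume "pp_class A = pp_class B"
  then show "pp_le A B \<and> pp_le B A"
    using mem_pp_class[OF assms(2)] unfolding pp_class_def by blast
next
  assume "pp_le A B \<and> pp_le B A"
  then show "pp_class A = pp_class B"
    unfolding pp_class_def using pp_le_trans assms by blast
qed

lemma class_le_iff:
  fixes A B :: "('s, 'a) struc"
  assumes "is_struc A" "is_struc B"
  shows "class_le (pp_class A) (pp_class B) \<longleftrightarrow> pp_le A B"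
proof
  assume "class_le (pp_class A) (pp_class B)"
  then obtain A' B' :: "('s, 'a) struc" where "is_struc A'" "is_struc B'" "pp_le A A'" "pp_le A' B'" "pp_le B' B"
    unfolding class_le_def pp_class_def by blast
  then show "pp_le A B" using pp_le_trans assms by blast
next
  assume "pp_le A B"
  then show "class_le (pp_class A) (pp_class B)"
    using mem_pp_class assms unfolding class_le_def by blast
qed

lemma digraph_is_struc: "digraph G \<Longrightarrow> is_struc G"
  unfolding digraph_def by blast

lemma union_of_cycles_C1: "union_of_cycles C1"
  unfolding union_of_cycles_def finite_digraph_iff by (auto simp: digraph_C1)

text \<open>Every vertex has an outgoing edge, so without a loop the construction of
  \<open>P1\<close> applies.\<close>

lemma union_of_cycles_loop_cases:
  fixes C :: "nat digraph"
  assumes C: "union_of_cycles C"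
  shows "pp_le C1 C \<or> pp_le C P1"
proof -
  have dC: "digraph C" using C by (rule union_of_cycles_digraph)
  obtain a where "a \<in> universe C" using digraph_universe_nonempty[OF dC] by blast
  then obtain b where "edge C a b" using C unfolding union_of_cycles_def by blast
  then show ?thesis using C1_le_loop[OF dC] loopless_le_P1[OF dC] by blast
qed

lemma P1_le_iff:
  assumes C: "union_of_cycles C"
  shows "pp_le P1 C \<longleftrightarrow> pp_le C1 C"
proof
  assume "pp_le P1 C"
  then obtain a where "edge C a a" using P1_le_union_of_cycles_loop[OF C] by blast
  then show "pp_le C1 C" by (rule C1_le_loop[OF union_of_cycles_digraph[OF C]])
next
  assume le: "pp_le C1 C"
  show "pp_le P1 C"
  proof (rule pp_le_trans[OF _ _ _ le])
    show "is_struc C1" using digraph_C1 by (rule digraph_is_struc)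
    show "is_struc C" using union_of_cycles_digraph[OF C] by (rule digraph_is_struc)
    show "pp_le P1 C1" by (rule pp_le_C1) simp
  qed
qed

text \<open>\<open>P1\<close> and unions of cycles are Maltsev as partial bijections. Conversely,
  paths with an edge give the class of \<open>P1\<close>, and the edgeless path gives that of
  \<open>C1\<close>, which is already in \<open>Poset_UC\<close>.\<close>

lemma Poset_Malt_eq: "Poset_Malt = insert (pp_class P1) Poset_UC"
proof
  have sP1: "is_struc P1" and sC1: "is_struc C1" using digraph_P1 digraph_C1 digraph_is_struc by blast+
  have "pp_class G \<in> insert (pp_class P1) Poset_UC"
    if G: "finite_digraph G" "has_quasi_maltsev G" for G :: "nat digraph"
  proof -
    have dG: "digraph G" and fin: "finite (universe G)" using G(1) unfolding finite_digraph_iff by blast+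
    have sG: "is_struc G" using dG by (rule digraph_is_struc)
    from quasi_maltsev_cases[OF dG fin G(2)] show ?thesis
    proof (elim disjE exE conjE)
      fix l assume l: "hom_equivalent G (path l)"
      have sp: "is_struc (path l)" using digraph_path digraph_is_struc by blast
      have "pp_class G = pp_class (path l)"
        using hom_equivalent_pp_le[OF sG sp l] hom_equivalent_pp_le[OF sp sG hom_equivalent_sym[OF l]]
        unfolding pp_class_eq_iff[OF sG sp] by blast
      moreover have "pp_class (path l) \<in> {pp_class C1, pp_class P1}"
      proof (cases "l = 0")
        case True
        have "pp_le C1 (path l)" by (rule C1_le_edgeless[OF digraph_path]) (use True in simp)
        moreover have "pp_le (path l) C1" by (rule pp_le_C1) simp
        ultimately show ?thesis using pp_class_eq_iff[OF sp sC1] by blast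
      next
        case False
        have "pp_le (path l) P1" by (rule loopless_le_P1[OF digraph_path, of _ 0 1]) (use False in auto)
        moreover have "pp_le P1 (path l)" using False by (intro P1_le_path) simp
        ultimately show ?thesis using pp_class_eq_iff[OF sp sP1] by blast
      qed
      moreover have "pp_class C1 \<in> Poset_UC" using union_of_cycles_C1 unfolding Poset_UC_def by blast
      ultimately show ?thesis by auto
    next
      fix C :: "nat digraph" assume C: "union_of_cycles C" "hom_equivalent G C"
      have sC: "is_struc C" using C(1) union_of_cycles_digraph digraph_is_struc by blast
      have "pp_class G = pp_class C"
        using hom_equivalent_pp_le[OF sG sC C(2)] hom_equivalent_pp_le[OF sC sG hom_equivalent_sym[OF C(2)]]
        unfolding pp_class_eq_iff[OF sG sC] by blast
      then show ?thesis using C(1) unfolding Poset_UC_def by blast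
    qed
  qed
  then show "Poset_Malt \<subseteq> insert (pp_class P1) Poset_UC" unfolding Poset_Malt_def by blast
  have "has_quasi_maltsev P1" by (rule partial_bijection_quasi_maltsev[OF digraph_P1]) auto
  then have "pp_class P1 \<in> Poset_Malt"
    using digraph_P1 unfolding Poset_Malt_def finite_digraph_iff by auto
  moreover have "Poset_UC \<subseteq> Poset_Malt"
    using union_of_cycles_quasi_maltsev unfolding Poset_UC_def Poset_Malt_def union_of_cycles_def by blast
  ultimately show "insert (pp_class P1) Poset_UC \<subseteq> Poset_Malt" by blast
qed

lemma Poset_Malt_upward_closed:
  assumes x: "x \<in> Poset_Malt" and y: "y \<in> Poset_Digraphs" and le: "class_le x y"
  shows "y \<in> Poset_Malt"
proof -
  obtain G where G: "x = pp_class G" "finite_digraph G" "has_quasi_maltsev G"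
    using x unfolding Poset_Malt_def by blast
  obtain H where H: "y = pp_class H" "finite_digraph H" using y unfolding Poset_Digraphs_def by blast
  have s: "is_struc G" "is_struc H" using G H unfolding finite_digraph_def by blast+
  then have "pp_le G H" using le class_le_iff unfolding G(1) H(1) by blast
  then have "has_quasi_maltsev H" using pp_le_quasi_maltsev s(2) G(3) by blast
  then show ?thesis using H unfolding Poset_Malt_def by blast
qed

theorem corollary2p80:
  shows "(pp_class P1 \<notin> Poset_UC \<and>
          (\<exists>f. order_iso f
                 (insert (pp_class P1) Poset_UC)
                 (insert_below class_le (pp_class P1) (pp_class C1))
                 Poset_Malt class_le \<and>
               f (pp_class P1) = pp_class P1)) \<and>
         covering Poset_Malt class_le =
           covering Poset_Digraphs class_le \<inter> (Poset_Malt \<times> Poset_Malt)"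
proof (intro conjI)
  have P1: "is_struc P1" and C1: "is_struc C1" using digraph_P1 digraph_C1 digraph_is_struc by blast+
  have UC: "is_struc C" if "union_of_cycles C" for C :: "nat digraph"
    using that union_of_cycles_digraph digraph_is_struc by blast
  have top: "pp_le C C1" if "union_of_cycles C" for C :: "nat digraph"
    by (rule pp_le_C1) (use UC[OF that] in \<open>simp add: is_struc_def\<close>)
  show notin: "pp_class P1 \<notin> Poset_UC"
  proof
    assume "pp_class P1 \<in> Poset_UC"
    then obtain C where C: "union_of_cycles C" "pp_class P1 = pp_class C"
      unfolding Poset_UC_def by blast
    then have "pp_le P1 C" "pp_le C P1" using pp_class_eq_iff[OF P1 UC] by blast+
    then show False using P1_le_iff[OF C(1)] pp_le_trans[OF UC[OF C(1)] P1] not_C1_le_P1 by blast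
  qed
  \<comment> \<open>\<open>below\<close> and \<open>above\<close> match the two branches of
    \<open>insert_below\<close> that mention the new element.\<close>
  have below: "class_le x (pp_class P1) \<longleftrightarrow> class_le x (pp_class C1) \<and> x \<noteq> pp_class C1"
    if "x \<in> Poset_UC" for x
  proof -
    obtain C where C: "union_of_cycles C" "x = pp_class C" using \<open>x \<in> Poset_UC\<close> unfolding Poset_UC_def by blast
    have "pp_le C P1 \<longleftrightarrow> \<not> pp_le C1 C"
      using union_of_cycles_loop_cases[OF C(1)] pp_le_trans[OF UC[OF C(1)] P1] not_C1_le_P1 by blast
    then show ?thesis
      unfolding C(2) class_le_iff[OF UC[OF C(1)] P1] class_le_iff[OF UC[OF C(1)] C1]
        pp_class_eq_iff[OF UC[OF C(1)] C1] using top[OF C(1)] by blast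
  qed
  have above: "class_le (pp_class P1) y \<longleftrightarrow> class_le (pp_class C1) y" if "y \<in> Poset_UC" for y
  proof -
    obtain C where C: "union_of_cycles C" "y = pp_class C" using \<open>y \<in> Poset_UC\<close> unfolding Poset_UC_def by blast
    show ?thesis
      unfolding C(2) class_le_iff[OF P1 UC[OF C(1)]] class_le_iff[OF C1 UC[OF C(1)]]
      by (rule P1_le_iff[OF C(1)])
  qed
  have "class_le (pp_class P1) (pp_class P1)" using class_le_iff[OF P1 P1] pp_le_refl[OF P1] by blast
  then have "insert_below class_le (pp_class P1) (pp_class C1) x y \<longleftrightarrow> class_le x y"
    if "x \<in> insert (pp_class P1) Poset_UC" "y \<in> insert (pp_class P1) Poset_UC" for x y
    using that notin below[of x] above[of y] unfolding insert_below_def by auto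
  then have "order_iso id (insert (pp_class P1) Poset_UC)
      (insert_below class_le (pp_class P1) (pp_class C1)) Poset_Malt class_le"
    unfolding order_iso_def Poset_Malt_eq by simp
  then show "\<exists>f. order_iso f (insert (pp_class P1) Poset_UC)
      (insert_below class_le (pp_class P1) (pp_class C1)) Poset_Malt class_le \<and>
      f (pp_class P1) = pp_class P1" by (metis id_apply)
  \<comment> \<open>An element strictly between two Maltsev classes lies above the lower one, hence
    is Maltsev itself, so it obstructs covering in both posets or in neither.\<close>
  have "Poset_Malt \<subseteq> Poset_Digraphs" unfolding Poset_Malt_def Poset_Digraphs_def by blast
  then show "covering Poset_Malt class_le =
      covering Poset_Digraphs class_le \<inter> (Poset_Malt \<times> Poset_Malt)"
    unfolding covering_def using Poset_Malt_upward_closed by blast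
qed

end
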